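(* Let $A=A^0\oplus\dotsb\oplus A^n$ be a commutative graded $\mathbb{R}$-algebra with a linear map $\deg_A\colon A^n\to\mathbb{R}$ satisfying Poincaré duality, let $r\ge1$, and let $c_i\in A^i$ for $1\le i\le r$. Let $\lambda$ be a partition, and choose some $m\ge 1$ with $\ell(\lambda) \le m \le r$. Let $$C = \frac{A[\zeta_1, \dotsc, \zeta_m]}{(\zeta_1^{r} - c_1 \zeta_1^{r-1} + \dotsb + (-1)^r c_r,\ \dotsc,\ \zeta_m^r - c_1 \zeta_{m}^{r-1} + \dotsb + (-1)^r c_r)}.$$ Then $$(-1)^{\binom{m}{2}} m!\, s_{\lambda} = p_* \left(\Delta^2 (\zeta_1 \dotsb \zeta_m)^{r-m} s_{\lambda}(\zeta_1, \dotsc, \zeta_m)\right) \quad\text{in } A.$$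
   Context: Poincaré duality means that for all $k\ge0$ the pairing $A^k\times A^{n-k}\to\mathbb{R}$, $(x,y)\mapsto\deg_A(xy)$, is nondegenerate. There is a decomposition $C=\bigoplus_{0\le i_1,\dots,i_m\le r-1}\zeta_1^{i_1}\cdots\zeta_m^{i_m}A$ of $A$-modules. The pushforward $p_*\colon C\to A$ is the $A$-linear map that sends $\zeta_1^{r-1}\cdots\zeta_m^{r-1}x$ to $x$ and is zero on all other summands; it is the adjoint of the inclusion $p^*\colon A\to C$ with respect to the Poincaré pairings, where $\deg_C(\zeta_1^{r-1}\cdots\zeta_m^{r-1}x)=\deg_A(x)$ for $x\in A^n$. $\Delta=\prod_{1\le i<j\le m}(\zeta_i-\zeta_j)\in C$ (with $\Delta=1$ if $m=1$), and $s_\lambda(\zeta_1,\dots,\zeta_m)\in C$ is the Schur polynomial of $\lambda$ in $m$ variables evaluated at $\zeta_1,\dots,\zeta_m$. Schur classes in $A$: define $s_i\in A^i$ by $(1-c_1+c_2-\dotsb+(-1)^rc_r)(s_0+s_1+\dotsb+s_n)=1$, and $s_i=0$ for $i<0$ or $i>n$. For a partition $\lambda$ with $\ell(\lambda)$ parts, $s_\lambda=\det(s_{\lambda_i+j-i})_{i,j=1}^{\ell(\lambda)}\in A^{|\lambda|}$, with $s_\emptyset=1$. *)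

theory Defs
  imports
    Complex_Main
    "HOL-Library.Poly_Mapping"
    "HOL-Library.FuncSet"
    "HOL-Algebra.QuotRing"
    "Jordan_Normal_Form.Determinant"
begin

section \<open>Graded algebras with Poincare duality\<close>

text \<open>The algebra is the whole type; \<open>G k\<close> is its graded piece of degree \<open>k\<close>.\<close>

definition graded_algebra ::
    "nat \<Rightarrow> (nat \<Rightarrow> 'a::{comm_ring_1,real_algebra_1} set) \<Rightarrow> bool" where
  "graded_algebra n G \<longleftrightarrow>
     (\<forall>k. subspace (G k)) \<and>
     (\<forall>k>n. G k = {0}) \<and>
     (\<forall>x. \<exists>!f. (\<forall>k. f k \<in> G k) \<and> x = (\<Sum>k\<le>n. f k)) \<and>
     1 \<in> G 0 \<and>
     (\<forall>i j. \<forall>x\<in>G i. \<forall>y\<in>G j. x * y \<in> G (i + j))"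

text \<open>A linear form on \<open>G n\<close> is represented by a function on the whole type of which only the
  values on \<open>G n\<close> matter.\<close>

definition linear_form_on :: "'a::real_vector set \<Rightarrow> ('a \<Rightarrow> real) \<Rightarrow> bool" where
  "linear_form_on V d \<longleftrightarrow>
     (\<forall>x\<in>V. \<forall>y\<in>V. d (x + y) = d x + d y) \<and> (\<forall>t. \<forall>x\<in>V. d (t *\<^sub>R x) = t * d x)"

text \<open>Degrees \<open>k > n\<close> carry no condition, since there \<open>G k\<close> (and the complementary piece of
  negative degree) is zero.\<close>

definition poincare_duality ::
    "nat \<Rightarrow> (nat \<Rightarrow> 'a::{comm_ring_1,real_algebra_1} set) \<Rightarrow> ('a \<Rightarrow> real) \<Rightarrow> bool" where
  "poincare_duality n G d \<longleftrightarrow>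
     (\<forall>k\<le>n. (\<forall>x\<in>G k. (\<forall>y\<in>G (n - k). d (x * y) = 0) \<longrightarrow> x = 0) \<and>
             (\<forall>y\<in>G (n - k). (\<forall>x\<in>G k. d (x * y) = 0) \<longrightarrow> y = 0))"


section \<open>Schur classes in the algebra\<close>

definition is_partition :: "nat list \<Rightarrow> bool" where
  "is_partition lam \<longleftrightarrow> sorted_wrt (\<ge>) lam \<and> (\<forall>x\<in>set lam. 0 < x)"

definition row_schur_class ::
    "nat \<Rightarrow> (nat \<Rightarrow> 'a::{comm_ring_1,real_algebra_1} set) \<Rightarrow> nat \<Rightarrow> (nat \<Rightarrow> 'a) \<Rightarrow> int \<Rightarrow> 'a" where
  "row_schur_class n G r c = (THE s.
     (\<forall>i\<le>n. s (int i) \<in> G i) \<and>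
     (\<forall>i. i < 0 \<or> int n < i \<longrightarrow> s i = 0) \<and>
     (1 + (\<Sum>i=1..r. (- 1) ^ i * c i)) * (\<Sum>i\<le>n. s (int i)) = 1)"

text \<open>The matrix is indexed from 0, which leaves \<open>j - i\<close> unchanged; \<open>lam ! i\<close> is the part
  number \<open>i + 1\<close>.\<close>

definition schur_class ::
    "nat \<Rightarrow> (nat \<Rightarrow> 'a::{comm_ring_1,real_algebra_1} set) \<Rightarrow> nat \<Rightarrow> (nat \<Rightarrow> 'a) \<Rightarrow> nat list \<Rightarrow> 'a" where
  "schur_class n G r c lam =
     det (mat (length lam) (length lam)
       (\<lambda>(i, j). row_schur_class n G r c (int (lam ! i) + int j - int i)))"


section \<open>Schur polynomials and Vandermonde products in a commutative ring\<close>

definition cells :: "nat list \<Rightarrow> (nat \<times> nat) set" where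
  "cells lam = {(i, j). i < length lam \<and> j < lam ! i}"

text \<open>Semistandard Young tableaux: weakly increasing along rows, strictly increasing down
  columns, with entries in \<open>{1..m}\<close>.\<close>

definition semistandard_tableaux :: "nat \<Rightarrow> nat list \<Rightarrow> (nat \<times> nat \<Rightarrow> nat) set" where
  "semistandard_tableaux m lam = {T \<in> cells lam \<rightarrow>\<^sub>E {1..m}.
     (\<forall>i j j'. (i, j) \<in> cells lam \<and> (i, j') \<in> cells lam \<and> j < j' \<longrightarrow> T (i, j) \<le> T (i, j')) \<and>
     (\<forall>i i' j. (i, j) \<in> cells lam \<and> (i', j) \<in> cells lam \<and> i < i' \<longrightarrow> T (i, j) < T (i', j))}"

definition schur_poly :: "('b, 'e) ring_scheme \<Rightarrow> nat \<Rightarrow> nat list \<Rightarrow> (nat \<Rightarrow> 'b) \<Rightarrow> 'b" where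
  "schur_poly R m lam x =
     (\<Oplus>\<^bsub>R\<^esub>T\<in>semistandard_tableaux m lam. \<Otimes>\<^bsub>R\<^esub>b\<in>cells lam. x (T b))"

definition vandermonde_prod :: "('b, 'e) ring_scheme \<Rightarrow> nat \<Rightarrow> (nat \<Rightarrow> 'b) \<Rightarrow> 'b" where
  "vandermonde_prod R m x =
     (\<Otimes>\<^bsub>R\<^esub>b\<in>{(i, j). 1 \<le> i \<and> i < j \<and> j \<le> m}. x (fst b) \<ominus>\<^bsub>R\<^esub> x (snd b))"


section \<open>The extension ring and its pushforward\<close>

text \<open>A polynomial is a finitely supported map from exponent vectors (finitely supported
  functions of the index of the variable) to coefficients; multiplication is convolution.\<close>

type_synonym 'a mpoly = "(nat \<Rightarrow>\<^sub>0 nat) \<Rightarrow>\<^sub>0 'a"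

definition const_poly :: "'a::zero \<Rightarrow> 'a mpoly" where
  "const_poly a = Poly_Mapping.single 0 a"

definition var_poly :: "nat \<Rightarrow> 'a::zero_neq_one mpoly" where
  "var_poly i = Poly_Mapping.single (Poly_Mapping.single i 1) 1"

definition mpoly_ring :: "nat \<Rightarrow> 'a::comm_ring_1 mpoly ring" where
  "mpoly_ring m =
     \<lparr>carrier = {p. \<forall>e\<in>Poly_Mapping.keys p. Poly_Mapping.keys e \<subseteq> {1..m}},
      monoid.mult = (*), one = 1, zero = 0, add = (+)\<rparr>"

definition relation_poly :: "nat \<Rightarrow> (nat \<Rightarrow> 'a::comm_ring_1) \<Rightarrow> nat \<Rightarrow> 'a mpoly" where
  "relation_poly r c i =
     var_poly i ^ r + (\<Sum>k=1..r. const_poly ((- 1) ^ k * c k) * var_poly i ^ (r - k))"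

definition relation_ideal :: "nat \<Rightarrow> (nat \<Rightarrow> 'a::comm_ring_1) \<Rightarrow> nat \<Rightarrow> 'a mpoly set" where
  "relation_ideal r c m = Idl\<^bsub>mpoly_ring m\<^esub> (relation_poly r c ` {1..m})"

definition ext_ring :: "nat \<Rightarrow> (nat \<Rightarrow> 'a::comm_ring_1) \<Rightarrow> nat \<Rightarrow> 'a mpoly set ring" where
  "ext_ring r c m = mpoly_ring m Quot relation_ideal r c m"

definition ext_class :: "nat \<Rightarrow> (nat \<Rightarrow> 'a::comm_ring_1) \<Rightarrow> nat \<Rightarrow> 'a mpoly \<Rightarrow> 'a mpoly set" where
  "ext_class r c m p = relation_ideal r c m +>\<^bsub>mpoly_ring m\<^esub> p"

definition zeta :: "nat \<Rightarrow> (nat \<Rightarrow> 'a::comm_ring_1) \<Rightarrow> nat \<Rightarrow> nat \<Rightarrow> 'a mpoly set" where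
  "zeta r c m i = ext_class r c m (var_poly i)"

definition pullback :: "nat \<Rightarrow> (nat \<Rightarrow> 'a::comm_ring_1) \<Rightarrow> nat \<Rightarrow> 'a \<Rightarrow> 'a mpoly set" where
  "pullback r c m a = ext_class r c m (const_poly a)"

definition zeta_monomial ::
    "nat \<Rightarrow> (nat \<Rightarrow> 'a::comm_ring_1) \<Rightarrow> nat \<Rightarrow> (nat \<Rightarrow> nat) \<Rightarrow> 'a mpoly set" where
  "zeta_monomial r c m e =
     (\<Otimes>\<^bsub>ext_ring r c m\<^esub>i\<in>{1..m}. zeta r c m i [^]\<^bsub>ext_ring r c m\<^esub> e i)"

definition is_pushforward ::
    "nat \<Rightarrow> (nat \<Rightarrow> 'a::comm_ring_1) \<Rightarrow> nat \<Rightarrow> ('a mpoly set \<Rightarrow> 'a) \<Rightarrow> bool" where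
  "is_pushforward r c m p \<longleftrightarrow>
     (\<forall>x\<in>carrier (ext_ring r c m). \<forall>y\<in>carrier (ext_ring r c m).
        p (x \<oplus>\<^bsub>ext_ring r c m\<^esub> y) = p x + p y) \<and>
     (\<forall>a. \<forall>x\<in>carrier (ext_ring r c m). p (pullback r c m a \<otimes>\<^bsub>ext_ring r c m\<^esub> x) = a * p x) \<and>
     (\<forall>e\<in>{1..m} \<rightarrow>\<^sub>E {0..r - 1}. \<forall>a.
        p (zeta_monomial r c m e \<otimes>\<^bsub>ext_ring r c m\<^esub> pullback r c m a) =
          (if \<forall>i\<in>{1..m}. e i = r - 1 then a else 0))"

text \<open>The value outside the carrier is fixed so that the map is unique as a function on the
  whole type.\<close>

definition pushforward ::
    "nat \<Rightarrow> (nat \<Rightarrow> 'a::comm_ring_1) \<Rightarrow> nat \<Rightarrow> 'a mpoly set \<Rightarrow> 'a" where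
  "pushforward r c m =
     (THE p. p \<in> extensional (carrier (ext_ring r c m)) \<and> is_pushforward r c m p)"

end

theory Submission
  imports Defs
begin

text \<open>The pushforward is computed by the functional that sends a monomial
  \<open>a \<zeta>\<^sub>1\<^bsup>e\<^sub>1\<^esup> \<cdots> \<zeta>\<^sub>m\<^bsup>e\<^sub>m\<^esup>\<close> of any degree to \<open>a \<Prod>\<^sub>i s\<^bsub>e\<^sub>i + 1 - r\<^esub>\<close>: the recursion satisfied by the
  classes \<open>s\<^sub>k\<close> says precisely that it kills the multiples of the relations. By the bialternant formula
  \<open>\<Delta> s\<^sub>\<lambda>(\<zeta>)\<close> is the determinant of the \<open>\<zeta>\<^sub>i\<^bsup>\<lambda>\<^sub>j + m - j\<^esup>\<close>, and \<open>\<Delta>\<close> is the case \<open>\<lambda> = \<emptyset>\<close>. Expanding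
  both determinants as sums over permutations, each of the \<open>m!\<close> permutations in the expansion of
  \<open>\<Delta> s\<^sub>\<lambda>\<close> contributes the Jacobi--Trudi determinant with its columns reversed, whose sign is
  \<open>(-1)\<^bsup>m(m-1)/2\<^esup>\<close>. The bialternant formula itself is proved by induction on \<open>m\<close>: tableau sums and
  alternants satisfy the same branching rule over interlacing partitions.\<close>

section \<open>Determinants and alternants\<close>

lemma det_mat_Leibniz:
  "det (mat n n (\<lambda>(i, j). f i j)) =
    (\<Sum>p | p permutes {0..<n}. of_int (sign p) * (\<Prod>i<n. f i (p i)))"
  by (subst det_def'[of _ n])
     (auto simp: permutes_in_image lessThan_atLeast0 intro!: sum.cong prod.cong)

lemma prod_permutes_image:
  fixes n :: nat
  assumes "p permutes {0..<n}"
  shows "(\<Prod>i<n. g (p i)) = (\<Prod>i<n. g i)"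
  using prod.permute[OF assms, of g] by (simp add: lessThan_atLeast0 o_def)

lemma det_mat_scale_cols:
  fixes d :: "nat \<Rightarrow> 'a::comm_ring_1"
  shows "det (mat n n (\<lambda>(i, j). d j * f i j)) = (\<Prod>j<n. d j) * det (mat n n (\<lambda>(i, j). f i j))"
  unfolding det_mat_Leibniz sum_distrib_left
  by (intro sum.cong) (auto simp: prod.distrib prod_permutes_image mult_ac)

lemma det_mat_scale_rows:
  fixes d :: "nat \<Rightarrow> 'a::comm_ring_1"
  shows "det (mat n n (\<lambda>(i, j). d i * f i j)) = (\<Prod>i<n. d i) * det (mat n n (\<lambda>(i, j). f i j))"
  unfolding det_mat_Leibniz sum_distrib_left
  by (intro sum.cong) (auto simp: prod.distrib mult_ac)

text \<open>Multilinearity in all rows at once: \<open>g\<close> records which summand is taken from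
  each row.\<close>

lemma det_mat_sum_rows:
  fixes f :: "nat \<Rightarrow> 'b \<Rightarrow> nat \<Rightarrow> 'a::comm_ring_1"
  assumes "\<And>i. i < n \<Longrightarrow> finite (K i)"
  shows "det (mat n n (\<lambda>(i, j). \<Sum>k\<in>K i. f i k j)) =
    (\<Sum>g\<in>PiE {..<n} K. det (mat n n (\<lambda>(i, j). f i (g i) j)))"
proof -
  have "(\<Prod>i<n. \<Sum>k\<in>K i. f i k (p i)) = (\<Sum>g\<in>PiE {..<n} K. \<Prod>i<n. f i (g i) (p i))" for p
    by (rule prod_sum_PiE) (auto simp: assms)
  then show ?thesis
    unfolding det_mat_Leibniz by (subst sum.swap) (simp add: sum_distrib_left)
qed

lemma det_last_row_unit:
  fixes f :: "nat \<Rightarrow> nat \<Rightarrow> 'a::comm_ring_1"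
  assumes "\<And>j. j \<le> n \<Longrightarrow> f n j = (if j = n then 1 else 0)"
  shows "det (mat (Suc n) (Suc n) (\<lambda>(i, j). f i j)) = det (mat n n (\<lambda>(i, j). f i j))"
proof -
  let ?A = "mat (Suc n) (Suc n) (\<lambda>(i, j). f i j)"
  have "det ?A = (\<Sum>j<Suc n. ?A $$ (n, j) * cofactor ?A n j)"
    by (rule laplace_expansion_row) auto
  also have "\<dots> = (\<Sum>j<Suc n. if j = n then cofactor ?A n n else 0)"
    by (intro sum.cong) (auto simp: assms)
  also have "\<dots> = cofactor ?A n n" by simp
  also have "\<dots> = det (mat_delete ?A n n)" by (simp add: cofactor_def)
  also have "mat_delete ?A n n = mat n n (\<lambda>(i, j). f i j)"
    by (auto simp: mat_delete_def)
  finally show ?thesis .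
qed

text \<open>Peels off unit rows from the bottom by Laplace expansion. It serves to pad a
  Jacobi-Trudi matrix with rows for zero parts.\<close>

lemma det_unitriangular_tail:
  fixes f :: "nat \<Rightarrow> nat \<Rightarrow> 'a::comm_ring_1"
  assumes "l \<le> n" "\<And>i j. l \<le> i \<Longrightarrow> j \<le> i \<Longrightarrow> f i j = (if j = i then 1 else 0)"
  shows "det (mat n n (\<lambda>(i, j). f i j)) = det (mat l l (\<lambda>(i, j). f i j))"
  using assms(1) by (induction rule: dec_induct) (auto simp: det_last_row_unit assms(2))

text \<open>Expansion along the first row leaves the antidiagonal matrix of size one less with
  cofactor sign \<open>(- 1) ^ n\<close>; the signs accumulate by Pascal's rule,
  \<open>n + (n choose 2) = Suc n choose 2\<close>.\<close>

lemma det_antidiagonal: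
  "det (mat n n (\<lambda>(i, j). if Suc (i + j) = n then 1 else 0)) = ((- 1) ^ (n choose 2) :: 'a::comm_ring_1)"
proof (induction n)
  case (Suc n)
  let ?A = "mat (Suc n) (Suc n) (\<lambda>(i, j). if Suc (i + j) = Suc n then 1 else (0::'a))"
  have "det ?A = (\<Sum>j<Suc n. ?A $$ (0, j) * cofactor ?A 0 j)"
    by (rule laplace_expansion_row) auto
  also have "\<dots> = (\<Sum>j<Suc n. if j = n then cofactor ?A 0 n else 0)"
    by (intro sum.cong) auto
  also have "\<dots> = cofactor ?A 0 n" by simp
  also have "\<dots> = (- 1) ^ n * det (mat_delete ?A 0 n)" by (simp add: cofactor_def)
  also have "mat_delete ?A 0 n = mat n n (\<lambda>(i, j). if Suc (i + j) = n then 1 else 0)"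
    by (auto simp: mat_delete_def)
  finally show ?case
    using Suc.IH by (simp add: numeral_2_eq_2 power_add)
qed (simp add: numeral_2_eq_2)

text \<open>Reversing the columns is right multiplication by the antidiagonal permutation
  matrix.\<close>

lemma det_reverse_cols:
  fixes f :: "nat \<Rightarrow> nat \<Rightarrow> 'a::comm_ring_1"
  shows "det (mat n n (\<lambda>(i, j). f i (n - 1 - j))) =
    (- 1) ^ (n choose 2) * det (mat n n (\<lambda>(i, j). f i j))"
proof -
  let ?A = "mat n n (\<lambda>(i, j). f i j)"
  let ?J = "mat n n (\<lambda>(i, j). if Suc (i + j) = n then 1 else (0::'a))"
  have "mat n n (\<lambda>(i, j). f i (n - 1 - j)) = ?A * ?J"
  proof (rule eq_matI)
    fix i j assume ij: "i < dim_row (?A * ?J)" "j < dim_col (?A * ?J)"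
    have "(?A * ?J) $$ (i, j) = (\<Sum>k\<in>{0..<n}. f i k * (if Suc (k + j) = n then 1 else 0))"
      using ij by (simp add: scalar_prod_def)
    also have "\<dots> = (\<Sum>k\<in>{0..<n}. if k = n - 1 - j then f i k else 0)"
      using ij by (intro sum.cong) auto
    also have "\<dots> = f i (n - 1 - j)" using ij by simp
    finally show "mat n n (\<lambda>(i, j). f i (n - 1 - j)) $$ (i, j) = (?A * ?J) $$ (i, j)"
      using ij by simp
  qed auto
  then show ?thesis
    by (simp add: det_mult[of _ n] det_antidiagonal)
qed

section \<open>Branching rule for alternants\<close>

text \<open>The geometric sum for \<open>x ^ (a - b) - y ^ (a - b)\<close>, multiplied by
  \<open>x ^ b\<close>. The summation index is the exponent of \<open>x\<close>, so it runs over the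
  half-open interval from \<open>b\<close> to \<open>a\<close>, which later becomes an interlacing
  condition.\<close>

lemma power_diff_scaled:
  fixes x y :: "'a::comm_ring_1"
  assumes "b \<le> a"
  shows "x ^ a - y ^ (a - b) * x ^ b = (x - y) * (\<Sum>k\<in>{b..<a}. y ^ (a - 1 - k) * x ^ k)"
  using assms
proof (induction rule: dec_induct)
  case (step a)
  define S where "S = (\<Sum>k\<in>{b..<a}. y ^ (a - 1 - k) * x ^ k)"
  have "(\<Sum>k\<in>{b..<a}. y ^ (a - k) * x ^ k) = y * S"
    unfolding S_def sum_distrib_left
  proof (intro sum.cong refl)
    fix k assume "k \<in> {b..<a}"
    then have "a - k = Suc (a - 1 - k)" by auto
    then show "y ^ (a - k) * x ^ k = y * (y ^ (a - 1 - k) * x ^ k)" by simp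
  qed
  then have "(\<Sum>k\<in>{b..<Suc a}. y ^ (Suc a - 1 - k) * x ^ k) = x ^ a + y * S"
    using step(1) by simp
  then have "(x - y) * (\<Sum>k\<in>{b..<Suc a}. y ^ (Suc a - 1 - k) * x ^ k) =
      (x - y) * x ^ a + y * ((x - y) * S)"
    by (simp only: ring_distribs mult_ac)
  also have "\<dots> = x ^ Suc a - y ^ (Suc a - b) * x ^ b"
    unfolding step.IH[folded S_def, symmetric]
    using step(1) by (simp add: algebra_simps Suc_diff_le)
  finally show ?case by simp
qed simp

text \<open>Subtracting from each row a multiple of the next one clears the last column except for its
  last entry, and makes every other entry of column \<open>i\<close> divisible by \<open>x i - x m\<close>.\<close>

lemma alternant_branching:
  fixes x :: "nat \<Rightarrow> 'a::comm_ring_1"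
  assumes l: "\<And>j. j < m \<Longrightarrow> l (Suc j) < l j"
  shows "det (mat (Suc m) (Suc m) (\<lambda>(j, i). x i ^ l j)) =
    (\<Prod>i<m. x i - x m) * (\<Sum>k\<in>(\<Pi>\<^sub>E j\<in>{..<m}. {l (Suc j)..<l j}).
      x m ^ l m * (\<Prod>j<m. x m ^ (l j - 1 - k j)) * det (mat m m (\<lambda>(j, i). x i ^ k j)))"
proof -
  let ?A = "mat (Suc m) (Suc m) (\<lambda>(j, i). x i ^ l j)"
  \<comment> \<open>\<open>?U\<close> encodes the row operations; being upper unitriangular it
    preserves the determinant. The power of \<open>x m\<close> is the one that cancels the entries
    of column \<open>m\<close> above the last row.\<close>
  let ?U = "mat (Suc m) (Suc m) (\<lambda>(i, j). if i = j then 1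
    else if j = Suc i then - (x m ^ (l i - l (Suc i))) else 0)"
  let ?b = "\<lambda>j i. if j < m then x i ^ l j - x m ^ (l j - l (Suc j)) * x i ^ l (Suc j) else x i ^ l m"
  let ?B = "mat (Suc m) (Suc m) (\<lambda>(j, i). ?b j i)"
  have "det ?U = prod_list (diag_mat ?U)"
    by (rule det_upper_triangular[of _ "Suc m"]) (auto simp: upper_triangular_def)
  also have "\<dots> = 1" by (auto simp: prod_list_diag_prod)
  finally have detU: "det ?U = 1" .
  have "?U * ?A = ?B"
  proof (rule eq_matI)
    fix j i assume "j < dim_row ?B" "i < dim_col ?B"
    then have ji: "j < Suc m" "i < Suc m" by auto
    have "(?U * ?A) $$ (j, i) = (\<Sum>k\<in>{0..<Suc m}. (if j = k then 1
        else if k = Suc j then - (x m ^ (l j - l (Suc j))) else 0) * x i ^ l k)"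
      using ji by (simp add: scalar_prod_def)
    also have "\<dots> = (\<Sum>k\<in>{0..<Suc m}. (if k = j then x i ^ l k else 0)
        + (if k = Suc j then - (x m ^ (l j - l (Suc j))) * x i ^ l k else 0))"
      by (intro sum.cong) auto
    also have "\<dots> = ?b j i"
      using ji by (cases "j = m")
        (auto simp: sum.distrib simp del: sum.atLeast0_lessThan_Suc sum.op_ivl_Suc)
    finally show "(?U * ?A) $$ (j, i) = ?B $$ (j, i)" using ji by simp
  qed auto
  then have "det ?A = det ?B"
    using det_mult[of ?U "Suc m" ?A] detU by simp
  also have "det ?B = (\<Sum>j<Suc m. ?B $$ (j, m) * cofactor ?B j m)"
    by (rule laplace_expansion_column) auto
  also have "\<dots> = (\<Sum>j<Suc m. if j = m then x m ^ l m * cofactor ?B m m else 0)"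
  proof (intro sum.cong refl)
    fix j assume "j \<in> {..<Suc m}"
    then show "?B $$ (j, m) * cofactor ?B j m = (if j = m then x m ^ l m * cofactor ?B m m else 0)"
      using l[of j] by (auto simp flip: power_add)
  qed
  also have "\<dots> = x m ^ l m * det (mat_delete ?B m m)"
    by (simp add: cofactor_def)
  also have "mat_delete ?B m m = mat m m (\<lambda>(j, i). (x i - x m) *
      (\<Sum>k\<in>{l (Suc j)..<l j}. x m ^ (l j - 1 - k) * x i ^ k))"
  proof (rule eq_matI)
    fix j i assume "j < dim_row (mat m m (\<lambda>(j, i). (x i - x m) *
      (\<Sum>k\<in>{l (Suc j)..<l j}. x m ^ (l j - 1 - k) * x i ^ k)))"
      "i < dim_col (mat m m (\<lambda>(j, i). (x i - x m) *
      (\<Sum>k\<in>{l (Suc j)..<l j}. x m ^ (l j - 1 - k) * x i ^ k)))"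
    then show "mat_delete ?B m m $$ (j, i) = mat m m (\<lambda>(j, i). (x i - x m) *
      (\<Sum>k\<in>{l (Suc j)..<l j}. x m ^ (l j - 1 - k) * x i ^ k)) $$ (j, i)"
      using power_diff_scaled[of "l (Suc j)" "l j" "x i" "x m"] l[of j]
      by (simp add: mat_delete_def)
  qed (auto simp: mat_delete_def)
  \<comment> \<open>The factors \<open>x i - x m\<close> come out of the columns, multilinearity
    picks one exponent \<open>k j\<close> in each row, and the remaining powers of
    \<open>x m\<close> come out of the rows.\<close>
  also have "det \<dots> = (\<Prod>i<m. x i - x m) * (\<Sum>k\<in>(\<Pi>\<^sub>E j\<in>{..<m}. {l (Suc j)..<l j}).
      (\<Prod>j<m. x m ^ (l j - 1 - k j)) * det (mat m m (\<lambda>(j, i). x i ^ k j)))"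
    unfolding det_mat_scale_cols det_mat_sum_rows[OF finite_atLeastLessThan] det_mat_scale_rows ..
  finally show ?thesis by (simp add: sum_distrib_left mult_ac)
qed

section \<open>Branching of semistandard tableaux\<close>

text \<open>A shape is a function read only below \<open>m\<close>: zero parts are allowed and there
  are as many rows as variables, which suits an induction on \<open>m\<close>.\<close>

definition diagram :: "nat \<Rightarrow> (nat \<Rightarrow> nat) \<Rightarrow> (nat \<times> nat) set" where
  "diagram m l = {(i, j). i < m \<and> j < l i}"

text \<open>The semistandard condition for an arbitrary set of cells, so that shapes given by lists
  and by functions can be identified through their cells.\<close>

definition fillings :: "nat \<Rightarrow> (nat \<times> nat) set \<Rightarrow> (nat \<times> nat \<Rightarrow> nat) set" where
  "fillings m Y = {T \<in> Y \<rightarrow>\<^sub>E {1..m}.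
     (\<forall>i j j'. (i, j) \<in> Y \<and> (i, j') \<in> Y \<and> j < j' \<longrightarrow> T (i, j) \<le> T (i, j')) \<and>
     (\<forall>i i' j. (i, j) \<in> Y \<and> (i', j) \<in> Y \<and> i < i' \<longrightarrow> T (i, j) < T (i', j))}"

text \<open>For weakly decreasing \<open>l\<close> with \<open>m + 1\<close> rows, these are the
  shapes whose complement in \<open>l\<close> is a horizontal strip. Extensionality makes each shape
  occur exactly once.\<close>

definition interlacing :: "nat \<Rightarrow> (nat \<Rightarrow> nat) \<Rightarrow> (nat \<Rightarrow> nat) set" where
  "interlacing m l = (\<Pi>\<^sub>E i\<in>{..<m}. {l (Suc i)..l i})"

definition tableau_sum :: "nat \<Rightarrow> (nat \<Rightarrow> nat) \<Rightarrow> (nat \<Rightarrow> 'a) \<Rightarrow> 'a::comm_ring_1" where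
  "tableau_sum m l x = (\<Sum>T\<in>fillings m (diagram m l). \<Prod>b\<in>diagram m l. x (T b))"

lemma semistandard_tableaux_eq_fillings:
  "semistandard_tableaux m lam = fillings m (cells lam)"
  by (simp add: semistandard_tableaux_def fillings_def)

lemma mem_diagram [simp]: "(i, j) \<in> diagram m l \<longleftrightarrow> i < m \<and> j < l i"
  by (simp add: diagram_def)

lemma diagram_eq_Sigma: "diagram m l = (SIGMA i:{..<m}. {..<l i})"
  by auto

lemma finite_diagram [simp]: "finite (diagram m l)"
  by (simp add: diagram_eq_Sigma)

lemma finite_fillings [simp]: "finite Y \<Longrightarrow> finite (fillings m Y)"
  by (rule finite_subset[of _ "Y \<rightarrow>\<^sub>E {1..m}"]) (auto simp: fillings_def finite_PiE)

lemma finite_interlacing [simp]: "finite (interlacing m l)"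
  by (auto simp: interlacing_def intro: finite_PiE)

lemma fillings_undefined: "T \<in> fillings m Y \<Longrightarrow> b \<notin> Y \<Longrightarrow> T b = undefined"
  unfolding fillings_def using PiE_arb[of T Y "\<lambda>_. {1..m}" b] by blast

lemma interlacing_undefined: "u \<in> interlacing m l \<Longrightarrow> \<not> i < m \<Longrightarrow> u i = undefined"
  unfolding interlacing_def using PiE_arb[of u "{..<m}" _ i] by simp

lemma prod_diagram: "(\<Prod>b\<in>diagram m l. f b) = (\<Prod>i<m. \<Prod>j<l i. f (i, j))"
  by (simp add: diagram_eq_Sigma prod.Sigma split_def)

lemma antitone_onD:
  assumes "\<And>i. i < m \<Longrightarrow> (l (Suc i) :: nat) \<le> l i" "i \<le> k" "k \<le> m"
  shows "l k \<le> l i"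
  using assms(2,3)
proof (induction rule: dec_induct)
  case (step k)
  then show ?case using assms(1)[of k] by simp
qed simp

lemma interlacingD:
  assumes "u \<in> interlacing m l" "i < m"
  shows "l (Suc i) \<le> u i" "u i \<le> l i"
  using assms by (auto simp: interlacing_def dest!: PiE_mem)

lemma interlacing_antitone:
  assumes "u \<in> interlacing m l" "Suc i < m"
  shows "u (Suc i) \<le> u i"
  using interlacingD(2)[OF assms] interlacingD(1)[OF assms(1), of i] assms(2) by simp

text \<open>Deleting the entries \<open>m + 1\<close> of a tableau leaves a tableau whose shape interlaces.\<close>

definition inner_shape :: "nat \<Rightarrow> (nat \<Rightarrow> nat) \<Rightarrow> (nat \<times> nat \<Rightarrow> nat) \<Rightarrow> nat \<Rightarrow> nat" where
  "inner_shape m l T = (\<lambda>i\<in>{..<m}. card {j. j < l i \<and> T (i, j) \<le> m})"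

definition inner_filling :: "nat \<Rightarrow> (nat \<Rightarrow> nat) \<Rightarrow> (nat \<times> nat \<Rightarrow> nat) \<Rightarrow> nat \<times> nat \<Rightarrow> nat" where
  "inner_filling m l T = restrict T (diagram m (inner_shape m l T))"

text \<open>The candidate inverse of the deletion, for a prescribed inner shape
  \<open>u\<close>.\<close>

definition outer_filling ::
    "nat \<Rightarrow> (nat \<Rightarrow> nat) \<Rightarrow> (nat \<Rightarrow> nat) \<Rightarrow> (nat \<times> nat \<Rightarrow> nat) \<Rightarrow> nat \<times> nat \<Rightarrow> nat" where
  "outer_filling m l u T =
     (\<lambda>b\<in>diagram (Suc m) l. if b \<in> diagram m u then T b else Suc m)"

text \<open>If some \<open>j\<close> below the cardinality were missing from this downward closed
  set, the whole set would lie below \<open>j\<close> and have at most \<open>j\<close>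
  elements.\<close>

lemma initial_segment_card:
  assumes "\<And>j j'. j < j' \<Longrightarrow> j' < n \<Longrightarrow> P j' \<Longrightarrow> P j"
  shows "{j. j < n \<and> P j} = {..<card {j. j < n \<and> P j}}"
proof -
  let ?S = "{j. j < n \<and> P j}"
  have fin: "finite ?S" by simp
  have down: "{..j} \<subseteq> ?S" if "j \<in> ?S" for j
    using that assms by (auto simp: le_less)
  show ?thesis
  proof (rule card_subset_eq[symmetric, OF fin])
    show "{..<card ?S} \<subseteq> ?S"
    proof
      fix j assume j: "j \<in> {..<card ?S}"
      show "j \<in> ?S"
      proof (rule ccontr)
        assume n: "j \<notin> ?S"
        have "?S \<subseteq> {..<j}"
        proof
          fix k assume "k \<in> ?S"
          with down[OF this] n show "k \<in> {..<j}" by (auto simp: not_le[symmetric])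
        qed
        then have "card ?S \<le> j" using card_mono[of "{..<j}" ?S] by simp
        with j show False by simp
      qed
    qed
  qed simp
qed

context
  fixes m :: nat and l :: "nat \<Rightarrow> nat"
  assumes l: "\<And>i. i < m \<Longrightarrow> l (Suc i) \<le> l i"
begin

section \<open>Deleting the largest entry from a tableau\<close>

context
  fixes T assumes T: "T \<in> fillings (Suc m) (diagram (Suc m) l)"
begin

lemma fillings_range: "i \<le> m \<Longrightarrow> j < l i \<Longrightarrow> 1 \<le> T (i, j) \<and> T (i, j) \<le> Suc m"
  using T unfolding fillings_def by (auto dest!: PiE_mem[of _ _ _ "(i, j)"])

lemma fillings_row: "i \<le> m \<Longrightarrow> j < j' \<Longrightarrow> j' < l i \<Longrightarrow> T (i, j) \<le> T (i, j')"
  using T unfolding fillings_def by auto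

lemma fillings_col: "i < i' \<Longrightarrow> i' \<le> m \<Longrightarrow> j < l i' \<Longrightarrow> T (i, j) < T (i', j)"
  using T antitone_onD[of m l i i', OF l] unfolding fillings_def by auto

text \<open>Each step down a column raises the entry by at least one. In the last of the
  \<open>m + 1\<close> rows this bound meets the upper bound, so that row is constant.\<close>

lemma fillings_lower: "i \<le> m \<Longrightarrow> j < l i \<Longrightarrow> Suc i \<le> T (i, j)"
proof (induction i)
  case 0
  then show ?case using fillings_range[of 0 j] by simp
next
  case (Suc i)
  have "j < l i" using Suc.prems l[of i] by simp
  then have "Suc i \<le> T (i, j)" using Suc by simp
  also have "T (i, j) < T (Suc i, j)" using Suc.prems fillings_col[of i "Suc i" j] by simp
  finally show ?case by simp
qed

lemma fillings_last_row: "j < l m \<Longrightarrow> T (m, j) = Suc m"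
  using fillings_lower[of m j] fillings_range[of m j] by simp

text \<open>Rows increase weakly, so the entries at most \<open>m\<close> occupy an initial segment,
  whose length is their number.\<close>

lemma inner_shape_iff:
  assumes "i < m"
  shows "j < inner_shape m l T i \<longleftrightarrow> j < l i \<and> T (i, j) \<le> m"
proof -
  have "{j. j < l i \<and> T (i, j) \<le> m} = {..<card {j. j < l i \<and> T (i, j) \<le> m}}"
    by (rule initial_segment_card) (use assms fillings_row[of i] in fastforce)
  then show ?thesis
    using assms by (auto simp: inner_shape_def)
qed

lemma inner_shape_interlacing: "inner_shape m l T \<in> interlacing m l"
  unfolding interlacing_def
proof (rule PiE_I)
  fix i assume "i \<in> {..<m}"
  then have i: "i < m" by simp
  \<comment> \<open>A cell with a cell directly below it carries an entry smaller than one that is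
    at most \<open>Suc m\<close>, so it survives the deletion.\<close>
  have "j < inner_shape m l T i" if "j < l (Suc i)" for j
    using that i l[of i] fillings_col[of i "Suc i" j] fillings_range[of "Suc i" j]
    by (auto simp: inner_shape_iff)
  then have "l (Suc i) \<le> inner_shape m l T i" by (meson not_le less_irrefl)
  moreover have "inner_shape m l T i \<le> l i"
    using i inner_shape_iff[of i] by (meson not_le less_irrefl)
  ultimately show "inner_shape m l T i \<in> {l (Suc i)..l i}" by simp
qed (simp add: inner_shape_def)

lemma inner_filling_fillings:
  "inner_filling m l T \<in> fillings m (diagram m (inner_shape m l T))"
proof -
  have "inner_filling m l T \<in> diagram m (inner_shape m l T) \<rightarrow>\<^sub>E {1..m}"
    using fillings_range unfolding inner_filling_def
    by (intro restrict_PiE_iff[THEN iffD2]) (auto simp: diagram_def inner_shape_iff Suc_le_eq)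
  moreover have "T (i, j) \<le> T (i, j')" if "i < m" "j < j'" "j' < inner_shape m l T i" for i j j'
    using that fillings_row[of i j j'] by (simp add: inner_shape_iff)
  moreover have "T (i, j) < T (i', j)" if "i < i'" "i' < m" "j < inner_shape m l T i'" for i i' j
    using that fillings_col[of i i' j] by (simp add: inner_shape_iff)
  ultimately show ?thesis
    by (auto simp: fillings_def inner_filling_def)
qed

lemma outer_inner_filling:
  "outer_filling m l (inner_shape m l T) (inner_filling m l T) = T"
proof
  fix b :: "nat \<times> nat" obtain i j where b: "b = (i, j)" by force
  have ext: "T b = undefined" if "b \<notin> diagram (Suc m) l"
    using fillings_undefined[OF T that] .
  show "outer_filling m l (inner_shape m l T) (inner_filling m l T) b = T b"
  proof (cases "b \<in> diagram (Suc m) l")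
    case True
    then have ij: "i \<le> m" "j < l i" by (auto simp: b)
    show ?thesis
    proof (cases "i = m")
      case True
      then show ?thesis
        using ij fillings_last_row[of j] by (simp add: b outer_filling_def inner_filling_def)
    next
      case False
      then show ?thesis
        using ij fillings_range[of i j]
        by (auto simp: b outer_filling_def inner_filling_def inner_shape_iff le_Suc_eq)
    qed
  qed (simp add: ext outer_filling_def)
qed

end

section \<open>Inserting the largest entry into a tableau\<close>

context
  fixes u T assumes u: "u \<in> interlacing m l" and T: "T \<in> fillings m (diagram m u)"
begin

lemma diagram_interlacing_subset: "diagram m u \<subseteq> diagram (Suc m) l"
  using interlacingD(2)[OF u] by (force simp: diagram_def)

lemma outer_filling_inside: "(i, j) \<in> diagram m u \<Longrightarrow> outer_filling m l u T (i, j) = T (i, j)"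
  using subsetD[OF diagram_interlacing_subset, of "(i, j)"] by (simp add: outer_filling_def del: mem_diagram)

lemma inside_range: "(i, j) \<in> diagram m u \<Longrightarrow> 1 \<le> T (i, j) \<and> T (i, j) \<le> m"
  using T unfolding fillings_def by (auto dest!: PiE_mem[of _ _ _ "(i, j)"])

lemma outer_filling_outside:
  "(i, j) \<in> diagram (Suc m) l \<Longrightarrow> (i, j) \<notin> diagram m u \<Longrightarrow> outer_filling m l u T (i, j) = Suc m"
  by (auto simp: outer_filling_def)

lemma outer_filling_range:
  "(i, j) \<in> diagram (Suc m) l \<Longrightarrow> 1 \<le> outer_filling m l u T (i, j) \<and> outer_filling m l u T (i, j) \<le> Suc m"
  using inside_range[of i j] by (cases "(i, j) \<in> diagram m u") (auto simp: outer_filling_def)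

lemma outer_filling_fillings: "outer_filling m l u T \<in> fillings (Suc m) (diagram (Suc m) l)"
proof -
  let ?O = "outer_filling m l u T"
  have "?O \<in> diagram (Suc m) l \<rightarrow>\<^sub>E {1..Suc m}"
  proof (rule PiE_I)
    fix b assume "b \<in> diagram (Suc m) l"
    then show "?O b \<in> {1..Suc m}" using outer_filling_range by (cases b) auto
  qed (simp add: outer_filling_def)
  moreover have "?O (i, j) \<le> ?O (i, j')"
    if "(i, j) \<in> diagram (Suc m) l" "(i, j') \<in> diagram (Suc m) l" "j < j'" for i j j'
  \<comment> \<open>If the right cell is old, so is the left one; if it is new, it carries the
    maximal entry.\<close>
  proof (cases "(i, j') \<in> diagram m u")
    case True
    then have in1: "(i, j) \<in> diagram m u" using that by simp
    with True show ?thesis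
      using T that(3) unfolding outer_filling_inside[OF True] outer_filling_inside[OF in1]
      by (auto simp: fillings_def)
  next
    case False
    then show ?thesis
      using outer_filling_outside[OF that(2)] outer_filling_range[OF that(1)] by simp
  qed
  moreover have "?O (i, j) < ?O (i', j)"
    if "(i, j) \<in> diagram (Suc m) l" "(i', j) \<in> diagram (Suc m) l" "i < i'" for i i' j
  proof -
    \<comment> \<open>By interlacing \<open>j < l i' \<le> l (Suc i) \<le> u i\<close>: a cell with
      another cell below it is old, so no column receives two new entries.\<close>
    have in1: "(i, j) \<in> diagram m u"
    proof -
      have "j < l i'" "i' \<le> m" using that by auto
      moreover have "l i' \<le> l (Suc i)"
        using antitone_onD[of m l "Suc i" i', OF l] that by auto
      ultimately show ?thesis using interlacingD(1)[OF u, of i] that by simp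
    qed
    show ?thesis
    proof (cases "(i', j) \<in> diagram m u")
      case True
      then show ?thesis
        using T that(3) in1 unfolding outer_filling_inside[OF True] outer_filling_inside[OF in1]
        by (auto simp: fillings_def)
    next
      case False
      then show ?thesis
        using outer_filling_outside[OF that(2)] outer_filling_inside[OF in1] inside_range[OF in1]
        by simp
    qed
  qed
  ultimately show ?thesis by (simp add: fillings_def)
qed

lemma inner_shape_outer_filling: "inner_shape m l (outer_filling m l u T) = u"
proof
  fix i
  show "inner_shape m l (outer_filling m l u T) i = u i"
  proof (cases "i < m")
    case True
    have "j < inner_shape m l (outer_filling m l u T) i \<longleftrightarrow> j < u i" for j
      unfolding inner_shape_iff[OF outer_filling_fillings True]
      using True interlacingD(2)[OF u True] outer_filling_inside[of i j] inside_range[of i j]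
        outer_filling_outside[of i j]
      by (cases "j < u i") auto
    then show ?thesis by (metis linorder_neqE_nat less_irrefl)
  next
    case False
    then show ?thesis
      using interlacing_undefined[OF u] by (simp add: inner_shape_def)
  qed
qed

lemma inner_filling_outer_filling: "inner_filling m l (outer_filling m l u T) = T"
proof
  fix b
  show "inner_filling m l (outer_filling m l u T) b = T b"
    unfolding inner_filling_def inner_shape_outer_filling
    using fillings_undefined[OF T, of b] outer_filling_inside[of "fst b" "snd b"]
    by (cases "b \<in> diagram m u") simp_all
qed

text \<open>Row \<open>i < m\<close> receives \<open>l i - u i\<close> new cells, and all
  \<open>l m\<close> cells of the last row are new.\<close>

lemma prod_outer_filling:
  fixes x :: "nat \<Rightarrow> 'a::comm_ring_1"
  shows "(\<Prod>b\<in>diagram (Suc m) l. x (outer_filling m l u T b)) =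
    x (Suc m) ^ l m * (\<Prod>i<m. x (Suc m) ^ (l i - u i)) * (\<Prod>b\<in>diagram m u. x (T b))"
proof -
  let ?O = "outer_filling m l u T"
  have last: "(\<Prod>j<l m. x (?O (m, j))) = x (Suc m) ^ l m"
    using outer_filling_outside[of m] by simp
  have row: "(\<Prod>j<l i. x (?O (i, j))) = x (Suc m) ^ (l i - u i) * (\<Prod>j<u i. x (T (i, j)))"
    if i: "i < m" for i
  proof -
    have "{..<l i} = {..<u i} \<union> {u i..<l i}" using interlacingD(2)[OF u i] by auto
    then have "(\<Prod>j<l i. x (?O (i, j))) =
        (\<Prod>j<u i. x (?O (i, j))) * (\<Prod>j\<in>{u i..<l i}. x (?O (i, j)))"
      by (simp add: prod.union_disjoint ivl_disj_int)
    also have "(\<Prod>j<u i. x (?O (i, j))) = (\<Prod>j<u i. x (T (i, j)))"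
      using i outer_filling_inside[of i] by simp
    also have "(\<Prod>j\<in>{u i..<l i}. x (?O (i, j))) = (\<Prod>j\<in>{u i..<l i}. x (Suc m))"
      using i outer_filling_outside[of i] by (intro prod.cong) auto
    finally show ?thesis by (simp add: mult.commute)
  qed
  show ?thesis
    by (simp add: prod_diagram last row prod.distrib mult_ac)
qed

end

lemma prod_filling:
  fixes x :: "nat \<Rightarrow> 'a::comm_ring_1"
  assumes T: "T \<in> fillings (Suc m) (diagram (Suc m) l)"
  shows "(\<Prod>b\<in>diagram (Suc m) l. x (T b)) =
    x (Suc m) ^ l m * (\<Prod>i<m. x (Suc m) ^ (l i - inner_shape m l T i)) *
    (\<Prod>b\<in>diagram m (inner_shape m l T). x (inner_filling m l T b))"
  using prod_outer_filling[OF inner_shape_interlacing[OF T] inner_filling_fillings[OF T], of x]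
  by (simp only: outer_inner_filling[OF T])

text \<open>Deletion and insertion are mutually inverse, so tableaux correspond to pairs of an
  interlacing shape and a smaller tableau.\<close>

lemma tableau_sum_branching:
  fixes x :: "nat \<Rightarrow> 'a::comm_ring_1"
  shows "tableau_sum (Suc m) l x = (\<Sum>u\<in>interlacing m l.
    x (Suc m) ^ l m * (\<Prod>i<m. x (Suc m) ^ (l i - u i)) * tableau_sum m u x)"
proof -
  have "tableau_sum (Suc m) l x =
    (\<Sum>(u, T)\<in>(SIGMA u:interlacing m l. fillings m (diagram m u)).
      x (Suc m) ^ l m * (\<Prod>i<m. x (Suc m) ^ (l i - u i)) * (\<Prod>b\<in>diagram m u. x (T b)))"
    unfolding tableau_sum_def
    by (rule sum.reindex_bij_witness[where
          i = "\<lambda>(u, T). outer_filling m l u T" and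
          j = "\<lambda>T. (inner_shape m l T, inner_filling m l T)"])
       (auto simp: outer_inner_filling inner_shape_interlacing
         inner_filling_fillings inner_shape_outer_filling inner_filling_outer_filling
         outer_filling_fillings prod_filling)
  also have "\<dots> = (\<Sum>u\<in>interlacing m l. \<Sum>T\<in>fillings m (diagram m u).
      x (Suc m) ^ l m * (\<Prod>i<m. x (Suc m) ^ (l i - u i)) * (\<Prod>b\<in>diagram m u. x (T b)))"
    by (simp add: sum.Sigma)
  finally show ?thesis
    by (simp add: tableau_sum_def sum_distrib_left)
qed

end

section \<open>The bialternant formula\<close>

definition vandermonde :: "nat \<Rightarrow> (nat \<Rightarrow> 'a) \<Rightarrow> 'a::comm_ring_1" where
  "vandermonde m x = (\<Prod>b\<in>{(i, j). 1 \<le> i \<and> i < j \<and> j \<le> m}. x (fst b) - x (snd b))"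

lemma finite_index_pairs [simp]: "finite {(i, j). 1 \<le> i \<and> i < j \<and> j \<le> (m::nat)}"
  by (rule finite_subset[of _ "{..m} \<times> {..m}"]) auto

lemma vandermonde_0 [simp]: "vandermonde 0 x = 1"
proof -
  have *: "{(i, j). 1 \<le> i \<and> i < j \<and> j \<le> (0::nat)} = {}" by auto
  show ?thesis unfolding vandermonde_def * by simp
qed

lemma vandermonde_Suc:
  "vandermonde (Suc m) x = vandermonde m x * (\<Prod>i<m. x (Suc i) - x (Suc m))"
proof -
  let ?P = "\<lambda>m. {(i, j). 1 \<le> i \<and> i < j \<and> j \<le> (m::nat)}"
  have split: "?P (Suc m) = ?P m \<union> (\<lambda>i. (Suc i, Suc m)) ` {..<m}"
  proof (intro equalityI subsetI)
    fix b assume "b \<in> ?P (Suc m)"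
    then show "b \<in> ?P m \<union> (\<lambda>i. (Suc i, Suc m)) ` {..<m}"
      by (cases b, cases "snd b = Suc m") (auto intro!: image_eqI[of _ _ "fst b - 1"])
  qed auto
  have inj: "inj_on (\<lambda>i. (Suc i, Suc m)) {..<m}" by (simp add: inj_on_def)
  show ?thesis
    unfolding vandermonde_def split
    by (subst prod.union_disjoint[OF finite_index_pairs])
       (auto simp: prod.reindex[OF inj])
qed

lemma tableau_sum_0 [simp]: "tableau_sum 0 l x = 1"
proof -
  have "diagram 0 l = {}" by auto
  moreover have "fillings 0 {} = {\<lambda>_. undefined}" by (auto simp: fillings_def)
  ultimately show ?thesis by (simp add: tableau_sum_def)
qed

text \<open>Matches the index sets of the two branching rules: adding the staircase
  \<open>m - 1 - j\<close> turns \<open>l (Suc j) \<le> u j \<le> l j\<close> into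
  \<open>l (Suc j) + (m - Suc j) \<le> k j < l j + (m - j)\<close>.\<close>

lemma sum_interlacing_shift:
  fixes f :: "(nat \<Rightarrow> nat) \<Rightarrow> 'a::comm_monoid_add"
  shows "(\<Sum>k\<in>(\<Pi>\<^sub>E j\<in>{..<m}. {l (Suc j) + (m - Suc j)..<l j + (m - j)}). f k) =
    (\<Sum>u\<in>interlacing m l. f (\<lambda>j\<in>{..<m}. u j + (m - 1 - j)))"
proof (rule sum.reindex_bij_witness[where
      i = "\<lambda>u. \<lambda>j\<in>{..<m}. u j + (m - 1 - j)" and j = "\<lambda>k. \<lambda>j\<in>{..<m}. k j - (m - 1 - j)"])
  let ?K = "\<Pi>\<^sub>E j\<in>{..<m}. {l (Suc j) + (m - Suc j)..<l j + (m - j)}"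
  fix k assume k: "k \<in> ?K"
  have kj: "l (Suc j) + (m - Suc j) \<le> k j \<and> k j < l j + (m - j)" if "j < m" for j
    using PiE_mem[OF k, of j] that by auto
  show *: "(\<lambda>j\<in>{..<m}. (\<lambda>j\<in>{..<m}. k j - (m - 1 - j)) j + (m - 1 - j)) = k"
  proof
    fix j show "(\<lambda>j\<in>{..<m}. (\<lambda>j\<in>{..<m}. k j - (m - 1 - j)) j + (m - 1 - j)) j = k j"
      using kj[of j] PiE_arb[OF k, of j] by (cases "j < m") auto
  qed
  show "(\<lambda>j\<in>{..<m}. k j - (m - 1 - j)) \<in> interlacing m l"
    unfolding interlacing_def
  proof (rule PiE_I)
    fix j assume "j \<in> {..<m}"
    then show "(\<lambda>j\<in>{..<m}. k j - (m - 1 - j)) j \<in> {l (Suc j)..l j}" using kj[of j] by auto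
  qed auto
  show "f (\<lambda>j\<in>{..<m}. (\<lambda>j\<in>{..<m}. k j - (m - 1 - j)) j + (m - 1 - j)) = f k"
    unfolding * ..
next
  fix u assume u: "u \<in> interlacing m l"
  show "(\<lambda>j\<in>{..<m}. (\<lambda>j\<in>{..<m}. u j + (m - 1 - j)) j - (m - 1 - j)) = u"
  proof
    fix j show "(\<lambda>j\<in>{..<m}. (\<lambda>j\<in>{..<m}. u j + (m - 1 - j)) j - (m - 1 - j)) j = u j"
      using interlacing_undefined[OF u, of j] by (cases "j < m") auto
  qed
  show "(\<lambda>j\<in>{..<m}. u j + (m - 1 - j)) \<in>
      (\<Pi>\<^sub>E j\<in>{..<m}. {l (Suc j) + (m - Suc j)..<l j + (m - j)})"
  proof (rule PiE_I)
    fix j assume "j \<in> {..<m}"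
    then show "(\<lambda>j\<in>{..<m}. u j + (m - 1 - j)) j \<in> {l (Suc j) + (m - Suc j)..<l j + (m - j)}"
      using interlacingD[OF u, of j] by auto
  qed auto
qed

text \<open>Monotonicity is asked only among the first \<open>m\<close> rows, because the
  interlacing shapes to which the induction hypothesis is applied are \<open>undefined\<close>
  beyond them.\<close>

theorem bialternant:
  fixes x :: "nat \<Rightarrow> 'a::comm_ring_1"
  assumes "\<And>i. Suc i < m \<Longrightarrow> l (Suc i) \<le> l i"
  shows "vandermonde m x * tableau_sum m l x =
    det (mat m m (\<lambda>(j, i). x (Suc i) ^ (l j + (m - 1 - j))))"
  using assms
proof (induction m arbitrary: l)
  case (Suc m)
  note anti = Suc.prems[OF Suc_mono]
  let ?y = "\<lambda>i. x (Suc i)" and ?L = "\<lambda>j. l j + (m - j)"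
  have IH: "det (mat m m (\<lambda>(j, i). ?y i ^ (u j + (m - 1 - j)))) = vandermonde m x * tableau_sum m u x"
    if "u \<in> interlacing m l" for u
    using Suc.IH[of u] interlacing_antitone[OF that] by simp
  have "det (mat (Suc m) (Suc m) (\<lambda>(j, i). ?y i ^ ?L j)) =
    (\<Prod>i<m. ?y i - ?y m) * (\<Sum>k\<in>(\<Pi>\<^sub>E j\<in>{..<m}. {?L (Suc j)..<?L j}).
      ?y m ^ ?L m * (\<Prod>j<m. ?y m ^ (?L j - 1 - k j)) * det (mat m m (\<lambda>(j, i). ?y i ^ k j)))"
  proof (rule alternant_branching)
    fix j assume "j < m"
    then show "?L (Suc j) < ?L j" using anti[of j] by simp
  qed
  \<comment> \<open>After reindexing by interlacing shapes the smaller determinants are the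
    alternants of these shapes, to which the induction hypothesis applies.\<close>
  also have "(\<Sum>k\<in>(\<Pi>\<^sub>E j\<in>{..<m}. {?L (Suc j)..<?L j}).
      ?y m ^ ?L m * (\<Prod>j<m. ?y m ^ (?L j - 1 - k j)) * det (mat m m (\<lambda>(j, i). ?y i ^ k j))) =
    (\<Sum>u\<in>interlacing m l. x (Suc m) ^ l m * (\<Prod>j<m. x (Suc m) ^ (l j - u j)) *
      (vandermonde m x * tableau_sum m u x))"
    unfolding sum_interlacing_shift
  proof (intro sum.cong refl)
    fix u assume u: "u \<in> interlacing m l"
    let ?k = "\<lambda>j\<in>{..<m}. u j + (m - 1 - j)"
    have "mat m m (\<lambda>(j, i). ?y i ^ ?k j) = mat m m (\<lambda>(j, i). ?y i ^ (u j + (m - 1 - j)))"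
      by (rule eq_matI) auto
    moreover have "(\<Prod>j<m. ?y m ^ (?L j - 1 - ?k j)) = (\<Prod>j<m. x (Suc m) ^ (l j - u j))"
    \<comment> \<open>The staircases for \<open>m + 1\<close> and for \<open>m\<close> variables
      differ by one in every row, so they cancel against the \<open>- 1\<close> in the
      exponent.\<close>
    proof (intro prod.cong refl)
      fix j assume "j \<in> {..<m}"
      then have "?L j - 1 - ?k j = l j - u j" using interlacingD[OF u, of j] by auto
      then show "?y m ^ (?L j - 1 - ?k j) = x (Suc m) ^ (l j - u j)" by (simp only:)
    qed
    ultimately show "?y m ^ ?L m * (\<Prod>j<m. ?y m ^ (?L j - 1 - ?k j)) *
        det (mat m m (\<lambda>(j, i). ?y i ^ ?k j)) =
      x (Suc m) ^ l m * (\<Prod>j<m. x (Suc m) ^ (l j - u j)) *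
        (vandermonde m x * tableau_sum m u x)"
      by (simp only: IH[OF u]) simp
  qed
  also have "\<dots> = vandermonde m x * tableau_sum (Suc m) l x"
  proof -
    have "tableau_sum (Suc m) l x = (\<Sum>u\<in>interlacing m l.
        x (Suc m) ^ l m * (\<Prod>i<m. x (Suc m) ^ (l i - u i)) * tableau_sum m u x)"
      using anti by (rule tableau_sum_branching)
    then show ?thesis by (simp add: sum_distrib_left mult_ac)
  qed
  finally show ?case
    by (simp add: vandermonde_Suc mult_ac)
qed simp

lemma tableau_sum_zero_shape: "tableau_sum m (\<lambda>_. 0) x = 1"
proof -
  have "diagram m (\<lambda>_. 0) = {}" by auto
  moreover have "fillings m {} = {\<lambda>_. undefined}" by (auto simp: fillings_def)
  ultimately show ?thesis by (simp add: tableau_sum_def)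
qed

corollary vandermonde_eq_det:
  "vandermonde m x = det (mat m m (\<lambda>(j, i). x (Suc i) ^ (m - 1 - j)))"
  using bialternant[of m "\<lambda>_. 0" x] by (simp add: tableau_sum_zero_shape)

section \<open>The extension ring\<close>

lemma mpoly_ring_simps [simp]:
  "x \<otimes>\<^bsub>mpoly_ring m\<^esub> y = x * y" "x \<oplus>\<^bsub>mpoly_ring m\<^esub> y = x + y"
  "\<one>\<^bsub>mpoly_ring m\<^esub> = 1" "\<zero>\<^bsub>mpoly_ring m\<^esub> = 0"
  by (simp_all add: mpoly_ring_def)

lemma mem_mpoly_carrier:
  "p \<in> carrier (mpoly_ring m) \<longleftrightarrow> (\<forall>e\<in>Poly_Mapping.keys p. Poly_Mapping.keys e \<subseteq> {1..m})"
  by (simp add: mpoly_ring_def)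

lemma mpoly_carrier_add:
  "p \<in> carrier (mpoly_ring m) \<Longrightarrow> q \<in> carrier (mpoly_ring m) \<Longrightarrow> p + q \<in> carrier (mpoly_ring m)"
  using keys_add[of p q] by (auto simp: mem_mpoly_carrier)

lemma mpoly_carrier_uminus:
  "p \<in> carrier (mpoly_ring m) \<Longrightarrow> - p \<in> carrier (mpoly_ring m)"
  by (simp add: mem_mpoly_carrier in_keys_iff)

lemma mpoly_carrier_diff:
  "p \<in> carrier (mpoly_ring m) \<Longrightarrow> q \<in> carrier (mpoly_ring m) \<Longrightarrow> p - q \<in> carrier (mpoly_ring m)"
  using mpoly_carrier_add[OF _ mpoly_carrier_uminus, of p m q] by simp

lemma mpoly_carrier_mult:
  "p \<in> carrier (mpoly_ring m) \<Longrightarrow> q \<in> carrier (mpoly_ring m) \<Longrightarrow> p * q \<in> carrier (mpoly_ring m)"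
  unfolding mem_mpoly_carrier
proof
  fix e assume p: "\<forall>e\<in>Poly_Mapping.keys p. Poly_Mapping.keys e \<subseteq> {1..m}"
    and q: "\<forall>e\<in>Poly_Mapping.keys q. Poly_Mapping.keys e \<subseteq> {1..m}"
    and "e \<in> Poly_Mapping.keys (p * q)"
  then obtain a b where "e = a + b" "a \<in> Poly_Mapping.keys p" "b \<in> Poly_Mapping.keys q"
    using keys_mult[of p q] by blast
  then show "Poly_Mapping.keys e \<subseteq> {1..m}"
    using keys_add[of a b] p q by blast
qed

lemma mpoly_carrier_single:
  "Poly_Mapping.keys e \<subseteq> {1..m} \<Longrightarrow> Poly_Mapping.single e a \<in> carrier (mpoly_ring m)"
  by (simp add: mem_mpoly_carrier)

lemma mpoly_carrier_const [simp]: "const_poly a \<in> carrier (mpoly_ring m)"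
  by (simp add: const_poly_def mpoly_carrier_single)

lemma mpoly_carrier_var: "i \<in> {1..m} \<Longrightarrow> var_poly i \<in> carrier (mpoly_ring m)"
  by (simp add: var_poly_def mpoly_carrier_single)

lemma cring_mpoly_ring: "cring (mpoly_ring m :: 'a::comm_ring_1 mpoly ring)"
proof (rule cringI)
  show "abelian_group (mpoly_ring m :: 'a mpoly ring)"
  proof (rule abelian_groupI)
    fix p :: "'a mpoly" assume "p \<in> carrier (mpoly_ring m)"
    then show "\<exists>q\<in>carrier (mpoly_ring m). q \<oplus>\<^bsub>mpoly_ring m\<^esub> p = \<zero>\<^bsub>mpoly_ring m\<^esub>"
      by (intro bexI[of _ "- p"]) (auto simp: mpoly_carrier_uminus)
  qed (auto simp: mpoly_carrier_add add_ac, simp add: mem_mpoly_carrier)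
  show "comm_monoid (mpoly_ring m :: 'a mpoly ring)"
    by (rule comm_monoidI) (auto simp: mpoly_carrier_mult mult_ac, simp add: mem_mpoly_carrier)
qed (simp add: ring_distribs)

lemma mpoly_carrier_zero [simp]: "0 \<in> carrier (mpoly_ring m)"
  and mpoly_carrier_one [simp]: "1 \<in> carrier (mpoly_ring m)"
  by (simp_all add: mem_mpoly_carrier)

lemma mpoly_carrier_power:
  "p \<in> carrier (mpoly_ring m) \<Longrightarrow> p ^ k \<in> carrier (mpoly_ring m)"
  by (induction k) (auto simp: mpoly_carrier_mult)

lemma mpoly_carrier_sum:
  "(\<And>a. a \<in> A \<Longrightarrow> f a \<in> carrier (mpoly_ring m)) \<Longrightarrow> sum f A \<in> carrier (mpoly_ring m)"
  by (induction A rule: infinite_finite_induct) (auto simp: mpoly_carrier_add)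

lemma mpoly_carrier_prod:
  "(\<And>a. a \<in> A \<Longrightarrow> f a \<in> carrier (mpoly_ring m)) \<Longrightarrow> prod f A \<in> carrier (mpoly_ring m)"
  by (induction A rule: infinite_finite_induct) (auto simp: mpoly_carrier_mult)

lemma mpoly_ring_minus:
  fixes p q :: "'a::comm_ring_1 mpoly"
  assumes "p \<in> carrier (mpoly_ring m)" "q \<in> carrier (mpoly_ring m)"
  shows "p \<ominus>\<^bsub>mpoly_ring m\<^esub> q = p - q"
proof -
  interpret cring "mpoly_ring m :: 'a mpoly ring" by (rule cring_mpoly_ring)
  have "\<ominus>\<^bsub>mpoly_ring m\<^esub> q = - q"
    by (rule minus_equality) (auto simp: assms mpoly_carrier_uminus)
  then show ?thesis by (simp add: a_minus_def)
qed

lemma mpoly_sum_singles: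
  "p = (\<Sum>e\<in>Poly_Mapping.keys p. Poly_Mapping.single e (Poly_Mapping.lookup p e))"
  by (rule poly_mapping_eqI) (auto simp: lookup_sum lookup_single when_def in_keys_iff)

lemma var_poly_power:
  "(var_poly i :: 'a::comm_ring_1 mpoly) ^ k = Poly_Mapping.single (Poly_Mapping.single i k) 1"
  by (induction k) (auto simp: var_poly_def mult_single simp flip: single_add)

lemma prod_var_poly_power:
  assumes "finite A"
  shows "(\<Prod>i\<in>A. (var_poly i :: 'a::comm_ring_1 mpoly) ^ e i) =
    Poly_Mapping.single (\<Sum>i\<in>A. Poly_Mapping.single i (e i)) 1"
  using assms by induction (auto simp: var_poly_power mult_single)

lemma lookup_sum_single:
  assumes "finite A"
  shows "Poly_Mapping.lookup (\<Sum>i\<in>A. Poly_Mapping.single i (e i)) j = (if j \<in> A then e j else 0)"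
  using assms by (auto simp: lookup_sum lookup_single when_def)

section \<open>The quotient ring: identities of polynomials transported along the quotient
  map\<close>

lemma relation_poly_carrier:
  "i \<in> {1..m} \<Longrightarrow> relation_poly r c i \<in> carrier (mpoly_ring m)"
  unfolding relation_poly_def
  by (intro mpoly_carrier_add mpoly_carrier_sum mpoly_carrier_mult mpoly_carrier_power)
     (auto simp: mpoly_carrier_var)

lemma ideal_relation_ideal: "ideal (relation_ideal r c m) (mpoly_ring m)"
  unfolding relation_ideal_def
  by (intro ring.genideal_ideal cring.axioms(1) cring_mpoly_ring) (auto intro: relation_poly_carrier)

lemma relation_poly_in_ideal: "i \<in> {1..m} \<Longrightarrow> relation_poly r c i \<in> relation_ideal r c m"
  unfolding relation_ideal_def
  by (rule subsetD[OF ring.genideal_self[OF cring.axioms(1)[OF cring_mpoly_ring]]])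
     (auto intro: relation_poly_carrier)

lemma cring_ext_ring: "cring (ext_ring r c m)"
  unfolding ext_ring_def
  by (intro ideal.quotient_is_cring ideal_relation_ideal cring_mpoly_ring)

lemma ext_class_hom: "ring_hom_cring (mpoly_ring m) (ext_ring r c m) (ext_class r c m)"
proof -
  have "ext_class r c m = (+>\<^bsub>mpoly_ring m\<^esub>) (relation_ideal r c m)"
    by (auto simp: ext_class_def)
  then show ?thesis
    unfolding ext_ring_def
    by (simp add: ideal.rcos_ring_hom_cring[OF ideal_relation_ideal cring_mpoly_ring])
qed

lemma carrier_ext_ring: "carrier (ext_ring r c m) = ext_class r c m ` carrier (mpoly_ring m)"
  by (auto simp: ext_ring_def FactRing_def A_RCOSETS_def' ext_class_def)

lemma ext_class_eq_iff:
  fixes p q :: "'a::comm_ring_1 mpoly"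
  assumes "p \<in> carrier (mpoly_ring m)" "q \<in> carrier (mpoly_ring m)"
  shows "ext_class r c m p = ext_class r c m q \<longleftrightarrow> p - q \<in> relation_ideal r c m"
proof -
  interpret cring "mpoly_ring m :: 'a mpoly ring" by (rule cring_mpoly_ring)
  show ?thesis
    using quotient_eq_iff_same_a_r_cos[OF ideal_relation_ideal assms, of r c]
    by (simp add: ext_class_def mpoly_ring_minus[OF assms])
qed

context
  fixes r m :: nat and c :: "nat \<Rightarrow> 'a::comm_ring_1"
begin

interpretation hom: ring_hom_cring "mpoly_ring m :: 'a mpoly ring" "ext_ring r c m" "ext_class r c m"
  by (rule ext_class_hom)

lemma ext_class_closed: "p \<in> carrier (mpoly_ring m) \<Longrightarrow> ext_class r c m p \<in> carrier (ext_ring r c m)"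
  by (rule hom.hom_closed)

lemma ext_class_mult:
  "p \<in> carrier (mpoly_ring m) \<Longrightarrow> q \<in> carrier (mpoly_ring m) \<Longrightarrow>
    ext_class r c m (p * q) = ext_class r c m p \<otimes>\<^bsub>ext_ring r c m\<^esub> ext_class r c m q"
  using hom.hom_mult[of p q] by simp

lemma ext_class_add:
  "p \<in> carrier (mpoly_ring m) \<Longrightarrow> q \<in> carrier (mpoly_ring m) \<Longrightarrow>
    ext_class r c m (p + q) = ext_class r c m p \<oplus>\<^bsub>ext_ring r c m\<^esub> ext_class r c m q"
  using hom.hom_add[of p q] by simp

lemma ext_class_diff:
  assumes "p \<in> carrier (mpoly_ring m)" "q \<in> carrier (mpoly_ring m)"
  shows "ext_class r c m (p - q) = ext_class r c m p \<ominus>\<^bsub>ext_ring r c m\<^esub> ext_class r c m q"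
proof -
  have "ext_class r c m (p \<ominus>\<^bsub>mpoly_ring m\<^esub> q) =
      ext_class r c m p \<ominus>\<^bsub>ext_ring r c m\<^esub> ext_class r c m q"
    using assms by (simp add: a_minus_def hom.R.a_inv_closed del: mpoly_ring_simps)
  then show ?thesis by (simp add: mpoly_ring_minus assms)
qed

lemma ext_class_power:
  "p \<in> carrier (mpoly_ring m) \<Longrightarrow>
    ext_class r c m (p ^ k) = ext_class r c m p [^]\<^bsub>ext_ring r c m\<^esub> (k::nat)"
proof (induction k)
  case 0
  show ?case using hom.hom_one by simp
next
  case (Suc k)
  then show ?case
    by (simp add: ext_class_mult mpoly_carrier_power mult.commute[of p])
qed

lemma ext_class_sum:
  assumes "finite A" "\<And>a. a \<in> A \<Longrightarrow> f a \<in> carrier (mpoly_ring m)"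
  shows "ext_class r c m (sum f A) = (\<Oplus>\<^bsub>ext_ring r c m\<^esub>a\<in>A. ext_class r c m (f a))"
  using assms
proof (induction A rule: finite_induct)
  case empty
  show ?case using hom.hom_zero by simp
next
  case (insert a A)
  then show ?case
    by (subst hom.S.finsum_insert)
       (auto simp: ext_class_add ext_class_closed mpoly_carrier_sum)
qed

lemma ext_class_prod:
  assumes "finite A" "\<And>a. a \<in> A \<Longrightarrow> f a \<in> carrier (mpoly_ring m)"
  shows "ext_class r c m (prod f A) = (\<Otimes>\<^bsub>ext_ring r c m\<^esub>a\<in>A. ext_class r c m (f a))"
  using assms
proof (induction A rule: finite_induct)
  case empty
  show ?case using hom.hom_one by simp
next
  case (insert a A)
  then show ?case
    by (subst hom.S.finprod_insert)
       (auto simp: ext_class_mult ext_class_closed mpoly_carrier_prod)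
qed

end

section \<open>The pushforward\<close>

text \<open>The coefficients of the inverse of the polynomial \<open>1 - c\<^sub>1 + c\<^sub>2 - \<dots>\<close>, extended by zero to
  negative indices; they are the values of the pushforward on powers of one variable.\<close>

locale inverse_coefficients =
  fixes r :: nat and c :: "nat \<Rightarrow> 'a::comm_ring_1" and h :: "int \<Rightarrow> 'a"
  assumes h_neg: "k < 0 \<Longrightarrow> h k = 0"
    and h_zero: "h 0 = 1"
    and h_rec: "k > 0 \<Longrightarrow> h k + (\<Sum>j=1..r. (- 1) ^ j * c j * h (k - int j)) = 0"
    and r_pos: "1 \<le> r"
begin

text \<open>The offset gives reduced monomials their prescribed values: exponent
  \<open>r - 1\<close> yields \<open>h 0 = 1\<close>, and a smaller exponent yields \<open>h\<close>
  at a negative index, which is 0.\<close>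

definition monom_value :: "nat \<Rightarrow> (nat \<Rightarrow>\<^sub>0 nat) \<Rightarrow> 'a" where
  "monom_value m e = (\<Prod>i\<in>{1..m}. h (int (Poly_Mapping.lookup e i) + 1 - int r))"

definition push_poly :: "nat \<Rightarrow> 'a mpoly \<Rightarrow> 'a" where
  "push_poly m p = (\<Sum>e\<in>Poly_Mapping.keys p. Poly_Mapping.lookup p e * monom_value m e)"

lemma push_poly_superset:
  assumes "finite S" "Poly_Mapping.keys p \<subseteq> S"
  shows "push_poly m p = (\<Sum>e\<in>S. Poly_Mapping.lookup p e * monom_value m e)"
  unfolding push_poly_def using assms
  by (intro sum.mono_neutral_left) (auto simp: in_keys_iff)

lemma push_poly_add: "push_poly m (p + q) = push_poly m p + push_poly m q"
proof -
  let ?S = "Poly_Mapping.keys p \<union> Poly_Mapping.keys q"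
  have "push_poly m (p + q) = (\<Sum>e\<in>?S. Poly_Mapping.lookup (p + q) e * monom_value m e)"
    by (rule push_poly_superset) (auto simp: keys_add)
  also have "\<dots> = (\<Sum>e\<in>?S. Poly_Mapping.lookup p e * monom_value m e)
      + (\<Sum>e\<in>?S. Poly_Mapping.lookup q e * monom_value m e)"
    by (simp add: lookup_add ring_distribs sum.distrib)
  also have "\<dots> = push_poly m p + push_poly m q"
    by (subst (1 2) push_poly_superset[of ?S]) auto
  finally show ?thesis .
qed

lemma push_poly_zero [simp]: "push_poly m 0 = 0"
  by (simp add: push_poly_def)

lemma push_poly_sum: "push_poly m (sum f A) = (\<Sum>a\<in>A. push_poly m (f a))"
  by (induction A rule: infinite_finite_induct) (auto simp: push_poly_add)

lemma push_poly_single: "push_poly m (Poly_Mapping.single e a) = a * monom_value m e"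
  by (simp add: push_poly_def)

lemma push_poly_uminus: "push_poly m (- p) = - push_poly m p"
  using push_poly_add[of m p "- p"] by (simp add: eq_neg_iff_add_eq_0 add.commute)

lemma push_poly_diff: "push_poly m (p - q) = push_poly m p - push_poly m q"
  using push_poly_add[of m p "- q"] by (simp add: push_poly_uminus)

lemma push_poly_single_mult:
  "push_poly m (Poly_Mapping.single e a * q) =
    (\<Sum>f\<in>Poly_Mapping.keys q. a * Poly_Mapping.lookup q f * monom_value m (e + f))"
  by (subst mpoly_sum_singles[of q])
     (simp only: sum_distrib_left mult_single push_poly_sum push_poly_single)

lemma push_poly_const_mult: "push_poly m (const_poly a * p) = a * push_poly m p"
  unfolding const_poly_def push_poly_single_mult
  unfolding push_poly_def sum_distrib_left by (simp add: mult.assoc)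

text \<open>Isolates the one factor that changes when a relation in variable \<open>i\<close> is
  applied.\<close>

lemma monom_value_split:
  assumes "i \<in> {1..m}"
  shows "monom_value m (e + Poly_Mapping.single i k) =
    h (int (Poly_Mapping.lookup e i) + int k + 1 - int r) *
    (\<Prod>j\<in>{1..m} - {i}. h (int (Poly_Mapping.lookup e j) + 1 - int r))"
  unfolding monom_value_def
  by (subst prod.remove[OF _ assms])
     (auto simp: lookup_add lookup_single when_def intro!: prod.cong)

text \<open>The relation changes only the exponent of variable \<open>i\<close>; the other factors
  come out, and what remains is the recursion \<open>h_rec\<close> at the positive index
  \<open>?n\<close>.\<close>

lemma push_poly_single_mult_relation:
  assumes "i \<in> {1..m}"
  shows "push_poly m (Poly_Mapping.single e a * relation_poly r c i) = 0"
proof -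
  let ?n = "int (Poly_Mapping.lookup e i) + 1"
  let ?R = "\<Prod>j\<in>{1..m} - {i}. h (int (Poly_Mapping.lookup e j) + 1 - int r)"
  have "Poly_Mapping.single e a * relation_poly r c i =
      Poly_Mapping.single (e + Poly_Mapping.single i r) a +
      (\<Sum>k=1..r. Poly_Mapping.single (e + Poly_Mapping.single i (r - k)) (a * ((- 1) ^ k * c k)))"
    by (simp add: relation_poly_def var_poly_power const_poly_def mult_single ring_distribs
        sum_distrib_left)
  then have "push_poly m (Poly_Mapping.single e a * relation_poly r c i) =
      a * (h ?n * ?R) + (\<Sum>k=1..r. a * ((- 1) ^ k * c k) * (h (?n - int k) * ?R))"
    by (simp add: push_poly_add push_poly_sum push_poly_single monom_value_split[OF assms]
        of_nat_diff algebra_simps)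
  also have "\<dots> = a * ?R * (h ?n + (\<Sum>k=1..r. (- 1) ^ k * c k * h (?n - int k)))"
    by (simp add: ring_distribs sum_distrib_left mult_ac)
  also have "\<dots> = 0" by (subst h_rec) simp_all
  finally show ?thesis .
qed

lemma push_poly_mult_relation:
  assumes "i \<in> {1..m}"
  shows "push_poly m (q * relation_poly r c i) = 0"
  by (subst mpoly_sum_singles[of q])
     (simp add: sum_distrib_right push_poly_sum push_poly_single_mult_relation[OF assms])

text \<open>The kernel of \<open>push_poly\<close> is not visibly closed under multiplication. The
  polynomials all of whose multiples are killed form an ideal by construction, and it contains the
  generators.\<close>

lemma push_poly_ideal:
  assumes "p \<in> relation_ideal r c m"
  shows "push_poly m p = 0"
proof -
  let ?R = "mpoly_ring m :: 'a mpoly ring"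
  let ?J = "{p \<in> carrier ?R. \<forall>q. push_poly m (q * p) = 0}"
  interpret cring ?R by (rule cring_mpoly_ring)
  have "ideal ?J ?R"
  proof (rule idealI[OF ring_axioms])
    have inv: "\<ominus>\<^bsub>?R\<^esub> p = - p" if "p \<in> carrier ?R" for p
      using mpoly_ring_minus[of 0 m p] that by (simp add: a_minus_def)
    show "subgroup ?J (add_monoid ?R)"
      by (rule add.subgroupI)
         (auto simp: inv mpoly_carrier_add mpoly_carrier_uminus ring_distribs push_poly_add
           push_poly_uminus intro: exI[of _ 0])
  next
    fix p q assume *: "p \<in> ?J" "q \<in> carrier ?R"
    have "push_poly m (s * (q * p)) = 0" for s
      using * by (simp flip: mult.assoc)
    with * show "q \<otimes>\<^bsub>?R\<^esub> p \<in> ?J" by (simp add: mpoly_carrier_mult)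
    with * show "p \<otimes>\<^bsub>?R\<^esub> q \<in> ?J" by (simp add: mult.commute)
  qed
  moreover have "relation_poly r c ` {1..m} \<subseteq> ?J"
    by (auto simp: relation_poly_carrier push_poly_mult_relation)
  ultimately have "relation_ideal r c m \<subseteq> ?J"
    unfolding relation_ideal_def by (rule genideal_minimal)
  then have "push_poly m (1 * p) = 0" using assms by blast
  then show ?thesis by simp
qed

text \<open>The representative is arbitrary: two choices differ by an element of the ideal, which
  \<open>push_poly\<close> kills.\<close>

definition push_class :: "nat \<Rightarrow> 'a mpoly set \<Rightarrow> 'a" where
  "push_class m = (\<lambda>X\<in>carrier (ext_ring r c m).
     push_poly m (SOME p. p \<in> carrier (mpoly_ring m) \<and> ext_class r c m p = X))"

lemma push_class_ext_class:
  assumes "p \<in> carrier (mpoly_ring m)"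
  shows "push_class m (ext_class r c m p) = push_poly m p"
proof -
  let ?q = "SOME q. q \<in> carrier (mpoly_ring m) \<and> ext_class r c m q = ext_class r c m p"
  have q: "?q \<in> carrier (mpoly_ring m) \<and> ext_class r c m ?q = ext_class r c m p"
    by (rule someI[of _ p]) (simp add: assms)
  then have "?q - p \<in> relation_ideal r c m"
    using ext_class_eq_iff[of ?q m p r c] assms by simp
  then have "push_poly m ?q = push_poly m p"
    using push_poly_ideal push_poly_diff by fastforce
  then show ?thesis
    using assms by (simp add: push_class_def ext_class_closed)
qed

lemma zeta_monomial_mult_pullback:
  "zeta_monomial r c m e \<otimes>\<^bsub>ext_ring r c m\<^esub> pullback r c m a =
    ext_class r c m (Poly_Mapping.single (\<Sum>i\<in>{1..m}. Poly_Mapping.single i (e i)) a)"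
proof -
  let ?M = "\<Prod>i\<in>{1..m}. (var_poly i :: 'a mpoly) ^ e i"
  have M: "?M \<in> carrier (mpoly_ring m)"
    by (intro mpoly_carrier_prod mpoly_carrier_power mpoly_carrier_var)
  interpret C: cring "ext_ring r c m" by (rule cring_ext_ring)
  have "zeta_monomial r c m e =
      (\<Otimes>\<^bsub>ext_ring r c m\<^esub>i\<in>{1..m}. ext_class r c m (var_poly i ^ e i))"
    unfolding zeta_monomial_def zeta_def
    by (rule C.finprod_cong')
       (auto simp: ext_class_power mpoly_carrier_var ext_class_closed intro!: C.nat_pow_closed)
  also have "\<dots> = ext_class r c m ?M"
    by (rule ext_class_prod[symmetric]) (auto simp: mpoly_carrier_var mpoly_carrier_power)
  finally have "zeta_monomial r c m e = ext_class r c m ?M" .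
  then have "zeta_monomial r c m e \<otimes>\<^bsub>ext_ring r c m\<^esub> pullback r c m a =
      ext_class r c m (?M * const_poly a)"
    by (simp only: pullback_def ext_class_mult[OF M mpoly_carrier_const])
  also have "?M * const_poly a = Poly_Mapping.single (\<Sum>i\<in>{1..m}. Poly_Mapping.single i (e i)) a"
    by (simp add: prod_var_poly_power const_poly_def mult_single)
  finally show ?thesis .
qed

lemma keys_sum_single:
  fixes m :: nat
  shows "Poly_Mapping.keys (\<Sum>i\<in>{1..m}. Poly_Mapping.single i (e i :: nat)) \<subseteq> {1..m}"
  by (auto simp: in_keys_iff lookup_sum_single split: if_splits)

lemma monom_value_sum_single:
  "monom_value m (\<Sum>i\<in>{1..m}. Poly_Mapping.single i (e i)) = (\<Prod>i\<in>{1..m}. h (int (e i) + 1 - int r))"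
  unfolding monom_value_def by (intro prod.cong) (auto simp: lookup_sum_single)

lemma monom_value_reduced:
  fixes m :: nat
  assumes "\<forall>i\<in>{1..m}. e i \<le> r - 1"
  shows "(\<Prod>i\<in>{1..m}. h (int (e i) + 1 - int r)) = (if \<forall>i\<in>{1..m}. e i = r - 1 then 1 else 0)"
proof (cases "\<forall>i\<in>{1..m}. e i = r - 1")
  case True
  then show ?thesis using r_pos by (simp add: of_nat_diff h_zero)
next
  case False
  then obtain i where i: "i \<in> {1..m}" "e i \<noteq> r - 1" by blast
  then have "e i \<le> r - 1" using assms by blast
  then have "h (int (e i) + 1 - int r) = 0"
    using i(2) r_pos by (intro h_neg) linarith
  then show ?thesis using False i(1) by (auto intro!: prod_zero)
qed

section \<open>Existence and uniqueness of the pushforward\<close>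

lemma is_pushforward_push_class: "is_pushforward r c m (push_class m)"
  unfolding is_pushforward_def
proof (intro conjI ballI allI)
  fix x y assume "x \<in> carrier (ext_ring r c m)" "y \<in> carrier (ext_ring r c m)"
  then show "push_class m (x \<oplus>\<^bsub>ext_ring r c m\<^esub> y) = push_class m x + push_class m y"
    by (auto simp: carrier_ext_ring push_class_ext_class push_poly_add mpoly_carrier_add
        simp flip: ext_class_add)
next
  fix a x assume "x \<in> carrier (ext_ring r c m)"
  then show "push_class m (pullback r c m a \<otimes>\<^bsub>ext_ring r c m\<^esub> x) = a * push_class m x"
    by (auto simp: carrier_ext_ring push_class_ext_class push_poly_const_mult mpoly_carrier_mult
        pullback_def simp flip: ext_class_mult)
next
  fix e a assume e: "e \<in> {1..m} \<rightarrow>\<^sub>E {0..r - 1}"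
  then have "\<forall>i\<in>{1..m}. e i \<le> r - 1" by (auto dest: PiE_mem)
  then show "push_class m (zeta_monomial r c m e \<otimes>\<^bsub>ext_ring r c m\<^esub> pullback r c m a) =
      (if \<forall>i\<in>{1..m}. e i = r - 1 then a else 0)"
    unfolding zeta_monomial_mult_pullback push_poly_single monom_value_sum_single
      push_class_ext_class[OF mpoly_carrier_single[OF keys_sum_single]]
    by (subst monom_value_reduced) auto
qed

text \<open>Induction on the total degree. Values on reduced monomials are prescribed; any other
  monomial is rewritten by a relation into monomials of smaller degree, and \<open>push_poly\<close>
  obeys the same rewriting.\<close>

lemma is_pushforward_single:
  assumes p: "is_pushforward r c m p" and "Poly_Mapping.keys e \<subseteq> {1..m}"
  shows "p (ext_class r c m (Poly_Mapping.single e a)) = a * monom_value m e"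
  using assms(2)
proof (induction "\<Sum>i\<in>{1..m}. Poly_Mapping.lookup e i" arbitrary: e a rule: less_induct)
  case less
  have add: "p (ext_class r c m (x + y)) = p (ext_class r c m x) + p (ext_class r c m y)"
    if "x \<in> carrier (mpoly_ring m)" "y \<in> carrier (mpoly_ring m)" for x y
    using p that unfolding is_pushforward_def by (simp add: ext_class_add ext_class_closed)
  have zero: "p (ext_class r c m 0) = 0"
    using add[of 0 0] by simp
  have sum: "p (ext_class r c m (sum f A)) = (\<Sum>x\<in>A. p (ext_class r c m (f x)))"
    if "\<And>x. x \<in> A \<Longrightarrow> f x \<in> carrier (mpoly_ring m)" for f and A :: "nat set"
    using that
    by (induction A rule: infinite_finite_induct) (auto simp: zero add mpoly_carrier_sum)
  show ?case
  proof (cases "\<forall>i\<in>{1..m}. Poly_Mapping.lookup e i \<le> r - 1")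
    case True
    \<comment> \<open>The prescribed values concern extensional exponent functions; restricting
      loses nothing, since all variables of \<open>e\<close> lie in \<open>{1..m}\<close>.\<close>
    define f where "f = (\<lambda>i\<in>{1..m}. Poly_Mapping.lookup e i)"
    have "Poly_Mapping.lookup e i = 0" if "i \<notin> {1..m}" for i
      using less.prems that by (meson in_keys_iff subsetD)
    then have e: "(\<Sum>i\<in>{1..m}. Poly_Mapping.single i (f i)) = e"
      by (intro poly_mapping_eqI) (auto simp: lookup_sum_single f_def)
    have f: "f \<in> {1..m} \<rightarrow>\<^sub>E {0..r - 1}" using True by (auto simp: f_def)
    have "p (ext_class r c m (Poly_Mapping.single e a)) =
        p (zeta_monomial r c m f \<otimes>\<^bsub>ext_ring r c m\<^esub> pullback r c m a)"
      unfolding zeta_monomial_mult_pullback e ..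
    also have "\<dots> = (if \<forall>i\<in>{1..m}. f i = r - 1 then a else 0)"
      using p f unfolding is_pushforward_def by blast
    also have "\<dots> = a * monom_value m e"
      using monom_value_reduced[of m f] True monom_value_sum_single[of m f] e
      by (auto simp: f_def)
    finally show ?thesis .
  next
    case False
    then obtain i where i: "i \<in> {1..m}" "r \<le> Poly_Mapping.lookup e i" by force
    \<comment> \<open>Chosen so that the monomial \<open>d\<close> times the relation in variable
      \<open>i\<close> has \<open>e\<close> as its leading exponent; the remaining terms
      \<open>?t k\<close> have degree lower by \<open>k\<close>.\<close>
    define d where "d = e - Poly_Mapping.single i r"
    have e: "d + Poly_Mapping.single i r = e"
      unfolding d_def using i(2)
      by (intro poly_mapping_eqI) (auto simp: lookup_add lookup_minus lookup_single when_def)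
    let ?t = "\<lambda>k. Poly_Mapping.single (d + Poly_Mapping.single i (r - k)) (a * ((- 1) ^ k * c k))"
    have keys: "Poly_Mapping.keys (d + Poly_Mapping.single i k) \<subseteq> {1..m}" for k
    proof -
      have "Poly_Mapping.keys d \<subseteq> Poly_Mapping.keys e"
        by (auto simp: d_def in_keys_iff lookup_minus)
      then show ?thesis
        using less.prems i(1) keys_add[of d "Poly_Mapping.single i k"]
        by (fastforce split: if_splits)
    qed
    have t: "?t k \<in> carrier (mpoly_ring m)" for k
      by (intro mpoly_carrier_single keys)
    have ed: "Poly_Mapping.single e a + (\<Sum>k=1..r. ?t k) =
        Poly_Mapping.single d a * relation_poly r c i"
      by (simp add: relation_poly_def var_poly_power const_poly_def mult_single ring_distribs
          sum_distrib_left e)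
    have dcar: "Poly_Mapping.single d a \<in> carrier (mpoly_ring m)"
      using keys[of 0] by (intro mpoly_carrier_single) simp
    have "Poly_Mapping.single d a * relation_poly r c i \<in> relation_ideal r c m"
      using ideal.I_l_closed[OF ideal_relation_ideal relation_poly_in_ideal[OF i(1)] dcar] by simp
    then have "ext_class r c m (Poly_Mapping.single e a + (\<Sum>k=1..r. ?t k)) = ext_class r c m 0"
      unfolding ed by (subst ext_class_eq_iff)
        (auto intro!: mpoly_carrier_mult dcar relation_poly_carrier i)
    then have p0: "p (ext_class r c m (Poly_Mapping.single e a)) + (\<Sum>k=1..r. p (ext_class r c m (?t k))) = 0"
      using add[of "Poly_Mapping.single e a" "\<Sum>k=1..r. ?t k"] sum[of "{1..r}" ?t] zero t
        mpoly_carrier_single[OF less.prems, of a] mpoly_carrier_sum[of "{1..r}" ?t]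
      by simp
    have "p (ext_class r c m (?t k)) = push_poly m (?t k)" if "k \<in> {1..r}" for k
    proof -
      have "(\<Sum>j\<in>{1..m}. Poly_Mapping.lookup (d + Poly_Mapping.single i (r - k)) j) <
          (\<Sum>j\<in>{1..m}. Poly_Mapping.lookup e j)"
        using that i(1) by (intro sum_strict_mono_ex1)
          (auto simp: lookup_add lookup_single when_def intro!: bexI[of _ i] simp flip: e)
      from less.hyps[OF this keys] show ?thesis by (simp add: push_poly_single)
    qed
    then have eq: "(\<Sum>k=1..r. p (ext_class r c m (?t k))) = (\<Sum>k=1..r. push_poly m (?t k))"
      by (rule sum.cong[OF refl])
    \<comment> \<open>Both functionals vanish on this multiple of the relation and agree on its
      lower terms, hence also on the leading one.\<close>
    have cancel: "u = v" if "u + s = 0" "v + s = 0" for u v s :: 'a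
      using that by (metis add_right_cancel)
    have "push_poly m (Poly_Mapping.single e a) + (\<Sum>k=1..r. push_poly m (?t k)) = 0"
      using push_poly_single_mult_relation[OF i(1), of d a]
      unfolding ed[symmetric] push_poly_add push_poly_sum .
    from cancel[OF p0[unfolded eq] this] show ?thesis by (simp only: push_poly_single)
  qed
qed

lemma is_pushforward_ext_class:
  assumes p: "is_pushforward r c m p" and q: "q \<in> carrier (mpoly_ring m)"
  shows "p (ext_class r c m q) = push_poly m q"
proof -
  let ?s = "\<lambda>e. Poly_Mapping.single e (Poly_Mapping.lookup q e)"
  have keys: "Poly_Mapping.keys e \<subseteq> {1..m}" if "e \<in> Poly_Mapping.keys q" for e
    using q that by (auto simp: mem_mpoly_carrier)
  have "p (ext_class r c m (sum ?s A)) = (\<Sum>e\<in>A. p (ext_class r c m (?s e)))"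
    if "finite A" "A \<subseteq> Poly_Mapping.keys q" for A
    using that
  proof (induction A rule: finite_induct)
    case empty
    show ?case using is_pushforward_single[OF p, of 0 0] by simp
  next
    case (insert e A)
    have "?s a \<in> carrier (mpoly_ring m)" if "a \<in> Poly_Mapping.keys q" for a
      by (intro mpoly_carrier_single keys that)
    then have "?s e \<in> carrier (mpoly_ring m)" "sum ?s A \<in> carrier (mpoly_ring m)"
      using insert.prems by (auto intro!: mpoly_carrier_sum)
    then show ?case
      using p insert unfolding is_pushforward_def by (simp add: ext_class_add ext_class_closed)
  qed
  from this[OF finite_keys subset_refl] show ?thesis
    using is_pushforward_single[OF p keys]
    by (simp add: push_poly_def flip: mpoly_sum_singles)
qed

text \<open>Existence and uniqueness identify the definite description with
  \<open>push_class\<close>, which can be evaluated on any representative.\<close>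

lemma pushforward_ext_class:
  assumes "p \<in> carrier (mpoly_ring m)"
  shows "pushforward r c m (ext_class r c m p) = push_poly m p"
proof -
  have "pushforward r c m = push_class m"
    unfolding pushforward_def
  proof (rule the_equality)
    show "push_class m \<in> extensional (carrier (ext_ring r c m)) \<and> is_pushforward r c m (push_class m)"
      using is_pushforward_push_class by (simp add: push_class_def)
  next
    fix f assume f: "f \<in> extensional (carrier (ext_ring r c m)) \<and> is_pushforward r c m f"
    show "f = push_class m"
    proof (rule extensionalityI)
      show "f \<in> extensional (carrier (ext_ring r c m))" using f by simp
      show "push_class m \<in> extensional (carrier (ext_ring r c m))" by (simp add: push_class_def)
      fix X assume "X \<in> carrier (ext_ring r c m)"
      then show "f X = push_class m X"
        using is_pushforward_ext_class[of m f] f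
        by (auto simp: carrier_ext_ring push_class_ext_class)
    qed
  qed
  then show ?thesis by (simp add: push_class_ext_class assms)
qed

end

section \<open>Row Schur classes\<close>

text \<open>The coefficients of the power series inverse of
  \<open>1 - c 1 t + c 2 t^2 - ...\<close>. The bound \<open>j \<le> k\<close> matters: truncated
  subtraction would otherwise produce the coefficient of index 0, which is 1.\<close>

fun inverse_coeff :: "nat \<Rightarrow> (nat \<Rightarrow> 'a::comm_ring_1) \<Rightarrow> nat \<Rightarrow> 'a" where
  "inverse_coeff r c k = (if k = 0 then 1
     else - (\<Sum>j\<in>{1..r} \<inter> {..k}. (- 1) ^ j * c j * inverse_coeff r c (k - j)))"

declare inverse_coeff.simps [simp del]

definition inverse_series :: "nat \<Rightarrow> (nat \<Rightarrow> 'a::comm_ring_1) \<Rightarrow> int \<Rightarrow> 'a" where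
  "inverse_series r c k = (if k < 0 then 0 else inverse_coeff r c (nat k))"

lemma inverse_coefficients_inverse_series:
  assumes "1 \<le> r"
  shows "inverse_coefficients r c (inverse_series r c)"
proof
  fix k :: int assume k: "k > 0"
  \<comment> \<open>The terms with \<open>j > k\<close> have negative index and vanish, in
    accordance with the truncated range.\<close>
  have "(\<Sum>j=1..r. (- 1) ^ j * c j * inverse_series r c (k - int j)) =
      (\<Sum>j\<in>{1..r} \<inter> {..nat k}. (- 1) ^ j * c j * inverse_coeff r c (nat k - j))"
    by (rule sum.mono_neutral_cong_right)
       (auto simp: inverse_series_def nat_diff_distrib' nat_less_iff not_le le_nat_iff)
  then show "inverse_series r c k + (\<Sum>j=1..r. (- 1) ^ j * c j * inverse_series r c (k - int j)) = 0"
    using k by (simp add: inverse_series_def inverse_coeff.simps[of r c "nat k"])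
qed (use assms in \<open>auto simp: inverse_series_def inverse_coeff.simps[of r c 0]\<close>)

text \<open>Collecting the product by the index \<open>k\<close> makes each coefficient an instance
  of the recursion, so only \<open>k = 0\<close> contributes.\<close>

lemma (in inverse_coefficients) inverse_product:
  assumes "\<And>k. int n < k \<Longrightarrow> h k = 0"
  shows "(1 + (\<Sum>i=1..r. (- 1) ^ i * c i)) * (\<Sum>i\<le>n. h (int i)) = 1"
proof -
  \<comment> \<open>The support of \<open>h\<close> lies in \<open>{0..n}\<close>, so the window of
    length \<open>n + r + 1\<close> still contains it after a shift by at most \<open>r\<close>;
    this gives all shifts a common range.\<close>
  have shift: "(\<Sum>k\<le>n + r. h (int k - int j)) = (\<Sum>i\<le>n. h (int i))" if "j \<le> r" for j
  proof -
    have "h (int k - int j) = 0" if "k \<notin> {j..n + j}" for k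
      using that assms[of "int k - int j"] h_neg[of "int k - int j"] by (cases "k < j") auto
    then have "(\<Sum>k\<le>n + r. h (int k - int j)) = (\<Sum>k\<in>{j..n + j}. h (int k - int j))"
      using that by (intro sum.mono_neutral_right) auto
    also have "\<dots> = (\<Sum>i\<le>n. h (int i))"
      by (rule sum.reindex_bij_witness[of _ "\<lambda>i. i + j" "\<lambda>k. k - j"]) (auto simp: of_nat_diff)
    finally show ?thesis .
  qed
  have "(1 + (\<Sum>i=1..r. (- 1) ^ i * c i)) * (\<Sum>i\<le>n. h (int i)) =
      (\<Sum>k\<le>n + r. h (int k - int 0)) +
      (\<Sum>i=1..r. (- 1) ^ i * c i * (\<Sum>k\<le>n + r. h (int k - int i)))"
    using shift[of 0] shift by (simp add: ring_distribs sum_distrib_right)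
  also have "\<dots> = (\<Sum>k\<le>n + r. h (int k) + (\<Sum>i=1..r. (- 1) ^ i * c i * h (int k - int i)))"
    unfolding sum_distrib_left by (subst sum.swap) (simp add: sum.distrib)
  also have "\<dots> = (\<Sum>k\<le>n + r. if k = 0 then 1 else 0)"
  proof (intro sum.cong refl)
    fix k
    show "h (int k) + (\<Sum>i=1..r. (- 1) ^ i * c i * h (int k - int i)) = (if k = 0 then 1 else 0)"
      using h_rec[of "int k"] by (cases "k = 0") (auto simp: h_zero h_neg intro!: sum.neutral)
  qed
  also have "\<dots> = 1" by simp
  finally show ?thesis .
qed

context
  fixes n r :: nat and G :: "nat \<Rightarrow> 'a::{comm_ring_1,real_algebra_1} set" and c :: "nat \<Rightarrow> 'a"
  assumes G: "graded_algebra n G" and c: "\<forall>i\<in>{1..r}. c i \<in> G i"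
begin

lemma graded_subspace: "subspace (G k)"
  using G unfolding graded_algebra_def by blast

lemma graded_zero: "0 \<in> G k"
  using graded_subspace by (rule real_vector.subspace_0)

lemma graded_uminus: "x \<in> G k \<Longrightarrow> - x \<in> G k"
  using graded_subspace by (rule real_vector.subspace_neg)

lemma graded_unique:
  assumes "\<And>k. f k \<in> G k" "\<And>k. g k \<in> G k" "(\<Sum>k\<le>n. f k) = (\<Sum>k\<le>n. g k)"
  shows "f = g"
proof -
  have "\<exists>!u. (\<forall>k. u k \<in> G k) \<and> (\<Sum>k\<le>n. f k) = (\<Sum>k\<le>n. u k)"
    using G unfolding graded_algebra_def by blast
  then show ?thesis using assms by blast
qed

lemma inverse_coeff_graded: "inverse_coeff r c k \<in> G k"
proof (induction k rule: less_induct)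
  case (less k)
  have one: "1 \<in> G 0" and mult: "\<And>i j x y. x \<in> G i \<Longrightarrow> y \<in> G j \<Longrightarrow> x * y \<in> G (i + j)"
    using G unfolding graded_algebra_def by blast+
  have "(- 1) ^ j * c j * inverse_coeff r c (k - j) \<in> G k" if "j \<in> {1..r} \<inter> {..k}" for j
  proof -
    have "c j * inverse_coeff r c (k - j) \<in> G (j + (k - j))"
      using that c by (intro mult less) auto
    then have "c j * inverse_coeff r c (k - j) \<in> G k" using that by simp
    then show ?thesis
      using graded_uminus[of "c j * inverse_coeff r c (k - j)" k] by (cases "even j") auto
  qed
  then have "(\<Sum>j\<in>{1..r} \<inter> {..k}. (- 1) ^ j * c j * inverse_coeff r c (k - j)) \<in> G k"
    by (rule real_vector.subspace_sum[OF graded_subspace])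
  then show ?case
    using one graded_uminus by (subst inverse_coeff.simps) auto
qed

text \<open>An inverse in a commutative ring is unique, which fixes the total sum; the grading then
  separates its homogeneous parts.\<close>

lemma row_schur_class_eq:
  assumes "1 \<le> r"
  shows "row_schur_class n G r c = inverse_series r c"
  unfolding row_schur_class_def
proof (rule the_equality)
  interpret inverse_coefficients r c "inverse_series r c"
    using assms by (rule inverse_coefficients_inverse_series)
  \<comment> \<open>Homogeneity puts the coefficients beyond \<open>n\<close> into zero graded
    pieces, so the recursive solution stops there.\<close>
  have "G k = {0}" if "n < k" for k
    using G that unfolding graded_algebra_def by blast
  then have vanish: "inverse_series r c k = 0" if "int n < k" for k
    using inverse_coeff_graded[of "nat k"] that by (auto simp: inverse_series_def zless_nat_eq_int_zless)
  show *: "(\<forall>i\<le>n. inverse_series r c (int i) \<in> G i) \<and>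
      (\<forall>i. i < 0 \<or> int n < i \<longrightarrow> inverse_series r c i = 0) \<and>
      (1 + (\<Sum>i=1..r. (- 1) ^ i * c i)) * (\<Sum>i\<le>n. inverse_series r c (int i)) = 1"
    using inverse_product[OF vanish] vanish h_neg
    by (auto simp: inverse_series_def inverse_coeff_graded)
  fix s
  assume s: "(\<forall>i\<le>n. s (int i) \<in> G i) \<and> (\<forall>i. i < 0 \<or> int n < i \<longrightarrow> s i = 0) \<and>
      (1 + (\<Sum>i=1..r. (- 1) ^ i * c i)) * (\<Sum>i\<le>n. s (int i)) = 1"
  let ?P = "1 + (\<Sum>i=1..r. (- 1) ^ i * c i)"
  let ?S = "\<Sum>i\<le>n. s (int i)" and ?H = "\<Sum>i\<le>n. inverse_series r c (int i)"
  have "?S = ?S * (?P * ?H)" using * by simp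
  also have "\<dots> = (?P * ?S) * ?H" by (simp only: mult_ac)
  also have "\<dots> = ?H" using s by simp
  finally have SH: "?S = ?H" .
  \<comment> \<open>Extension by zero makes both families homogeneous in every degree, as uniqueness
    of the decomposition requires.\<close>
  have "(\<lambda>k. if k \<le> n then s (int k) else 0) = (\<lambda>k. if k \<le> n then inverse_series r c (int k) else 0)"
    using s * SH by (intro graded_unique) (auto simp: graded_zero)
  then have "s (int k) = inverse_series r c (int k)" if "k \<le> n" for k
    using that by (metis (mono_tags))
  then show "s = inverse_series r c"
    using s * by (intro ext) (metis linorder_not_le nat_0_le of_nat_le_iff)
qed

lemma inverse_coefficients_row_schur_class:
  "1 \<le> r \<Longrightarrow> inverse_coefficients r c (row_schur_class n G r c)"
  by (simp add: row_schur_class_eq inverse_coefficients_inverse_series)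

end

section \<open>Pushing forward the Schur polynomial\<close>

lemma (in inverse_coefficients) push_poly_of_int_mult:
  "push_poly m (of_int k * p) = of_int k * push_poly m p"
  using push_poly_const_mult[of m "of_int k" p] by (simp add: const_poly_def)

lemma prod_shift_index: "(\<Prod>i\<in>{1..m}. f i) = (\<Prod>i<m. f (Suc i))"
  by (rule prod.reindex_bij_witness[of _ Suc "\<lambda>i. i - 1"]) auto

lemma (in inverse_coefficients) push_poly_monomial:
  "push_poly m (\<Prod>i<m. var_poly (Suc i) ^ e i) = (\<Prod>i<m. h (int (e i) + 1 - int r))"
proof -
  have "(\<Prod>i<m. (var_poly (Suc i) :: 'a mpoly) ^ e i) =
      Poly_Mapping.single (\<Sum>i\<in>{1..m}. Poly_Mapping.single i (e (i - 1))) 1"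
    by (subst prod_var_poly_power[symmetric]) (simp_all add: prod_shift_index del: One_nat_def)
  then show ?thesis
    by (simp add: push_poly_single monom_value_sum_single prod_shift_index del: One_nat_def)
qed

text \<open>In this orientation the product runs over the columns, which in an alternant are the
  variables, so each term is a monomial whose exponents are read off from \<open>p\<close>.\<close>

lemma det_Leibniz_cols:
  "det (mat n n (\<lambda>(i, j). f i j)) =
    (\<Sum>p | p permutes {0..<n}. of_int (sign p) * (\<Prod>j<n. f (p j) j))"
  by (subst det_col[of _ n]) (auto simp: permutes_in_image intro!: sum.cong prod.cong)

lemma (in inverse_coefficients) push_poly_vandermonde_schur:
  assumes mr: "m \<le> r" and l: "\<And>i. Suc i < m \<Longrightarrow> l (Suc i) \<le> l i"
  shows "push_poly m (vandermonde m var_poly ^ 2 * (\<Prod>i\<in>{1..m}. var_poly i) ^ (r - m) *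
      tableau_sum m l var_poly) =
    (- 1) ^ (m choose 2) * of_nat (fact m) *
      det (mat m m (\<lambda>(i, j). h (int (l i) + int j - int i)))"
proof -
  let ?x = "\<lambda>i. var_poly (Suc i) :: 'a mpoly"
  let ?P = "{p. p permutes {0..<m}}"
  let ?H = "\<lambda>i j. h (int (l i) + int j - int i)"
  \<comment> \<open>The exponent of variable \<open>i\<close>: from the Vandermonde term
    \<open>s\<close>, from the power \<open>r - m\<close> of the product of the variables, and from
    the alternant term \<open>t\<close>.\<close>
  let ?E = "\<lambda>s t i. (m - 1 - s i) + (r - m) + (l (t i) + (m - 1 - t i))"
  let ?sg = "\<lambda>s. of_int (sign s)"
  have V: "vandermonde m var_poly = (\<Sum>s\<in>?P. ?sg s * (\<Prod>i<m. ?x i ^ (m - 1 - s i)))"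
    unfolding vandermonde_eq_det det_Leibniz_cols ..
  have A: "vandermonde m var_poly * tableau_sum m l var_poly =
      (\<Sum>t\<in>?P. ?sg t * (\<Prod>i<m. ?x i ^ (l (t i) + (m - 1 - t i))))"
    using bialternant[of m l var_poly] l unfolding det_Leibniz_cols by simp
  have "vandermonde m var_poly ^ 2 * (\<Prod>i\<in>{1..m}. var_poly i) ^ (r - m) * tableau_sum m l var_poly =
      vandermonde m var_poly * (\<Prod>i<m. ?x i) ^ (r - m) *
      (vandermonde m var_poly * tableau_sum m l var_poly)"
    by (simp only: prod_shift_index power2_eq_square mult_ac)
  also have "\<dots> = (\<Sum>t\<in>?P. \<Sum>s\<in>?P. ?sg t * (?sg s * (\<Prod>i<m. ?x i ^ ?E s t i)))"
    \<comment> \<open>The order matters: one Vandermonde factor is first absorbed with the tableau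
      sum, and only the other is then expanded by itself.\<close>
    unfolding A unfolding V
    by (simp add: sum_distrib_right sum_distrib_left power_add prod.distrib prod_power_distrib mult_ac)
  finally have "push_poly m (vandermonde m var_poly ^ 2 * (\<Prod>i\<in>{1..m}. var_poly i) ^ (r - m) *
      tableau_sum m l var_poly) =
      (\<Sum>t\<in>?P. \<Sum>s\<in>?P. ?sg t * (?sg s * (\<Prod>i<m. h (int (?E s t i) + 1 - int r))))"
    by (simp only: push_poly_sum push_poly_of_int_mult push_poly_monomial)
  also have "\<dots> = (\<Sum>t\<in>?P. \<Sum>s\<in>?P. ?sg t * (?sg s * (\<Prod>i<m. ?H (t i) (m - 1 - s i))))"
  proof (intro sum.cong refl arg_cong2[where f = "(*)"] prod.cong)
    fix t s i assume "t \<in> ?P" "s \<in> ?P" "i \<in> {..<m}"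
    then have "t i < m" "s i < m"
      using permutes_in_image[of t "{0..<m}" i] permutes_in_image[of s "{0..<m}" i] by auto
    \<comment> \<open>The constants \<open>r - m\<close>, \<open>m - 1\<close> and
      \<open>1 - r\<close> add up to 0, leaving the index of the Jacobi-Trudi entry in row
      \<open>t i\<close> and column \<open>m - 1 - s i\<close>.\<close>
    then have "int (?E s t i) + 1 - int r = int (l (t i)) + int (m - 1 - s i) - int (t i)"
      using mr by (simp add: of_nat_diff)
    then show "h (int (?E s t i) + 1 - int r) = ?H (t i) (m - 1 - s i)" by (simp only:)
  qed
  also have "\<dots> = (\<Sum>t\<in>?P. ?sg t * det (mat m m (\<lambda>(i, j). ?H (t i) (m - 1 - j))))"
    by (simp add: det_mat_Leibniz sum_distrib_left)
  also have "\<dots> = (\<Sum>t\<in>?P. (- 1) ^ (m choose 2) * det (mat m m (\<lambda>(i, j). ?H i j)))"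
  proof (intro sum.cong refl)
    fix t assume t: "t \<in> ?P"
    let ?M = "mat m m (\<lambda>(i, j). ?H i (m - 1 - j))"
    have "mat m m (\<lambda>(i, j). ?H (t i) (m - 1 - j)) = mat m m (\<lambda>(i, j). ?M $$ (t i, j))"
      using t by (intro eq_matI) (auto simp: permutes_in_image)
    then have "det (mat m m (\<lambda>(i, j). ?H (t i) (m - 1 - j))) = ?sg t * det ?M"
      using det_permute_rows[of ?M m t] t by simp
    \<comment> \<open>The sign from permuting rows cancels the sign of \<open>t\<close> in the
      expansion, so every \<open>t\<close> contributes the same amount.\<close>
    moreover have "?sg t * (?sg t * y) = y" for y :: 'a
      by (simp add: sign_def)
    ultimately show "?sg t * det (mat m m (\<lambda>(i, j). ?H (t i) (m - 1 - j))) =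
        (- 1) ^ (m choose 2) * det (mat m m (\<lambda>(i, j). ?H i j))"
      by (simp only: det_reverse_cols[of m ?H])
  qed
  also have "\<dots> = (- 1) ^ (m choose 2) * of_nat (fact m) * det (mat m m (\<lambda>(i, j). ?H i j))"
    by (simp add: card_permutations[of "{0..<m}" m] mult_ac)
  finally show ?thesis .
qed

section \<open>Transfer to the extension ring\<close>

lemma vandermonde_prod_zeta:
  "vandermonde_prod (ext_ring r c m) m (zeta r c m) = ext_class r c m (vandermonde m var_poly)"
proof -
  interpret C: cring "ext_ring r c m" by (rule cring_ext_ring)
  show ?thesis
    unfolding vandermonde_prod_def vandermonde_def
  proof (subst ext_class_prod)
    show "(\<Otimes>\<^bsub>ext_ring r c m\<^esub>b\<in>{(i, j). 1 \<le> i \<and> i < j \<and> j \<le> m}.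
        zeta r c m (fst b) \<ominus>\<^bsub>ext_ring r c m\<^esub> zeta r c m (snd b)) =
      (\<Otimes>\<^bsub>ext_ring r c m\<^esub>b\<in>{(i, j). 1 \<le> i \<and> i < j \<and> j \<le> m}.
        ext_class r c m (var_poly (fst b) - var_poly (snd b)))"
      by (rule C.finprod_cong')
         (auto simp: zeta_def ext_class_diff mpoly_carrier_var 
           intro!: ext_class_closed mpoly_carrier_diff)
  qed (rule finite_index_pairs, auto intro!: mpoly_carrier_diff mpoly_carrier_var)
qed

lemma vandermonde_carrier: "vandermonde m var_poly \<in> carrier (mpoly_ring m)"
  unfolding vandermonde_def
  by (intro mpoly_carrier_prod mpoly_carrier_diff mpoly_carrier_var) auto

lemma tableau_prod_carrier:
  assumes "T \<in> fillings m Y"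
  shows "(\<Prod>b\<in>Y. var_poly (T b)) \<in> carrier (mpoly_ring m)"
  using assms by (intro mpoly_carrier_prod mpoly_carrier_var) (auto simp: fillings_def)

lemma tableau_sum_carrier: "tableau_sum m l var_poly \<in> carrier (mpoly_ring m)"
  unfolding tableau_sum_def by (intro mpoly_carrier_sum tableau_prod_carrier)

lemma schur_poly_zeta:
  assumes "cells lam = diagram m l"
  shows "schur_poly (ext_ring r c m) m lam (zeta r c m) = ext_class r c m (tableau_sum m l var_poly)"
proof -
  interpret C: cring "ext_ring r c m" by (rule cring_ext_ring)
  have T: "(\<Otimes>\<^bsub>ext_ring r c m\<^esub>b\<in>diagram m l. zeta r c m (T b)) =
      ext_class r c m (\<Prod>b\<in>diagram m l. var_poly (T b))"
    if "T \<in> fillings m (diagram m l)" for T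
  proof -
    have "T b \<in> {1..m}" if "b \<in> diagram m l" for b
      using \<open>T \<in> _\<close> that unfolding fillings_def by blast
    then show ?thesis
      unfolding zeta_def by (intro ext_class_prod[symmetric]) (auto intro: mpoly_carrier_var)
  qed
  have "schur_poly (ext_ring r c m) m lam (zeta r c m) =
      (\<Oplus>\<^bsub>ext_ring r c m\<^esub>T\<in>fillings m (diagram m l).
        ext_class r c m (\<Prod>b\<in>diagram m l. var_poly (T b)))"
    unfolding schur_poly_def semistandard_tableaux_eq_fillings assms
    by (rule C.finsum_cong') (auto simp: T intro!: ext_class_closed tableau_prod_carrier)
  also have "\<dots> = ext_class r c m (tableau_sum m l var_poly)"
    unfolding tableau_sum_def by (rule ext_class_sum[symmetric]) (auto intro: tableau_prod_carrier)
  finally show ?thesis .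
qed

theorem proposition1p6:
  fixes n r m :: nat
    and G :: "nat \<Rightarrow> 'a::{comm_ring_1,real_algebra_1} set"
    and deg :: "'a \<Rightarrow> real"
    and c :: "nat \<Rightarrow> 'a"
    and lam :: "nat list"
  assumes "graded_algebra n G"
    and "linear_form_on (G n) deg"
    and "poincare_duality n G deg"
    and "1 \<le> r"
    and "\<forall>i\<in>{1..r}. c i \<in> G i"
    and "is_partition lam"
    and "1 \<le> m" and "length lam \<le> m" and "m \<le> r"
  shows "let C = ext_ring r c m; z = zeta r c m in
    (- 1) ^ (m choose 2) * of_nat (fact m) * schur_class n G r c lam =
      pushforward r c m
        (vandermonde_prod C m z [^]\<^bsub>C\<^esub> (2::nat)
          \<otimes>\<^bsub>C\<^esub> (\<Otimes>\<^bsub>C\<^esub>i\<in>{1..m}. z i) [^]\<^bsub>C\<^esub> (r - m)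
          \<otimes>\<^bsub>C\<^esub> schur_poly C m lam z)"
proof -
  let ?C = "ext_ring r c m" and ?h = "row_schur_class n G r c"
  \<comment> \<open>The partition padded with zero parts, to have one row for each variable.\<close>
  define l where "l = (\<lambda>i. if i < length lam then lam ! i else 0)"
  interpret inverse_coefficients r c ?h
    using assms(1,5,4) by (rule inverse_coefficients_row_schur_class)
  have cells: "cells lam = diagram m l"
    using assms(8) by (auto simp: cells_def l_def split: if_splits)
  have l: "l (Suc i) \<le> l i" for i
    using assms(6) by (auto simp: l_def is_partition_def sorted_wrt_iff_nth_less)
  have zprod: "(\<Otimes>\<^bsub>?C\<^esub>i\<in>{1..m}. zeta r c m i) = ext_class r c m (\<Prod>i\<in>{1..m}. var_poly i)"
    unfolding zeta_def by (rule ext_class_prod[symmetric]) (auto intro: mpoly_carrier_var)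
  have pc: "(\<Prod>i\<in>{1..m}. var_poly i) \<in> carrier (mpoly_ring m)"
    by (intro mpoly_carrier_prod mpoly_carrier_var)
  \<comment> \<open>Each factor is the class of an explicit polynomial, so the whole product can be
    formed among polynomials.\<close>
  have "vandermonde_prod ?C m (zeta r c m) [^]\<^bsub>?C\<^esub> (2::nat)
        \<otimes>\<^bsub>?C\<^esub> (\<Otimes>\<^bsub>?C\<^esub>i\<in>{1..m}. zeta r c m i) [^]\<^bsub>?C\<^esub> (r - m)
        \<otimes>\<^bsub>?C\<^esub> schur_poly ?C m lam (zeta r c m) =
      ext_class r c m (vandermonde m var_poly ^ 2 * (\<Prod>i\<in>{1..m}. var_poly i) ^ (r - m) *
        tableau_sum m l var_poly)"
    unfolding vandermonde_prod_zeta zprod schur_poly_zeta[OF cells]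
    by (simp only: ext_class_mult ext_class_power mpoly_carrier_mult mpoly_carrier_power
        vandermonde_carrier tableau_sum_carrier pc)
  moreover have "pushforward r c m (ext_class r c m
        (vandermonde m var_poly ^ 2 * (\<Prod>i\<in>{1..m}. var_poly i) ^ (r - m) *
          tableau_sum m l var_poly)) =
      (- 1) ^ (m choose 2) * of_nat (fact m) *
        det (mat m m (\<lambda>(i, j). ?h (int (l i) + int j - int i)))"
    using push_poly_vandermonde_schur[of m l] assms(9) l
    by (simp only: pushforward_ext_class mpoly_carrier_mult mpoly_carrier_power
        vandermonde_carrier tableau_sum_carrier pc)
  moreover have "det (mat m m (\<lambda>(i, j). ?h (int (l i) + int j - int i))) = schur_class n G r c lam"
  proof -
    have "det (mat m m (\<lambda>(i, j). ?h (int (l i) + int j - int i))) =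
        det (mat (length lam) (length lam) (\<lambda>(i, j). ?h (int (l i) + int j - int i)))"
      \<comment> \<open>In a padded row \<open>l i = 0\<close>, so the entries
        \<open>?h (j - i)\<close> are 1 on the diagonal and 0 to its left.\<close>
      using assms(8) by (rule det_unitriangular_tail) (auto simp: l_def h_zero h_neg)
    also have "mat (length lam) (length lam) (\<lambda>(i, j). ?h (int (l i) + int j - int i)) =
        mat (length lam) (length lam) (\<lambda>(i, j). ?h (int (lam ! i) + int j - int i))"
      by (rule eq_matI) (auto simp: l_def)
    finally show ?thesis unfolding schur_class_def .
  qed
  ultimately show ?thesis by (simp add: Let_def)
qed

end
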